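(* Let $q=p^e$ be an odd prime power with $q\equiv 2\pmod 3$, and let $3\le k\le e+2$. Let $g_i(X)=X^3$ and $f_i(X)=X^{p^{i-2}}$ for each $3\le i\le k$. Then $S(k,q)=S(k,q;f_3,g_3,\ldots,f_k,g_k)$ is connected and $$\lambda_2(S(k,q))\le\max\{q(p^{k-3}-1),\,(q-1)M_q\},$$ where $M_q=\max_{a,b\in\mathbb{F}_q^*}\varepsilon_{ax^3+bx}$, and moreover $M_q\le2\sqrt q$.
   Context: For a prime power $q$, integer $k\ge3$, and polynomials $f_i,g_i\in\mathbb{F}_q[X]$ ($3\le i\le k$) of degree at most $q-1$ with $g_i(-X)=-g_i(X)$, the graph $S(k,q;f_3,g_3,\ldots,f_k,g_k)$ is the simple graph with vertex set $\mathbb{F}_q^k$ in which $a=(a_1,\ldots,a_k)$ and $b=(b_1,\ldots,b_k)$ are adjacent iff $a_1\ne b_1$ and $b_i-a_i=g_i(b_1-a_1)\,f_i\!\left(\frac{b_2-a_2}{b_1-a_1}\right)$ for all $3\le i\le k$. $\lambda_2$ is the second largest adjacency eigenvalue. With $q=p^e$, $Tr(\alpha)=\alpha+\alpha^p+\cdots+\alpha^{p^{e-1}}\in\mathbb{F}_p$, $\zeta_p=\exp(2\pi i/p)$, and $\zeta_p^\beta$ for $\beta\in\mathbb{F}_p$ means $\zeta_p^{\beta^*}$ with $\beta^*\in\{0,\ldots,p-1\}$ the representative of $\beta$. For $f\in\mathbb{F}_q[X]$, the exponential sum is $\varepsilon_f=\sum_{x\in\mathbb{F}_q}\zeta_p^{Tr(f(x))}$.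 *)

theory Defs
  imports Complex_Main "Jordan_Normal_Form.Char_Poly"
begin

definition ff_trace :: "nat \<Rightarrow> nat \<Rightarrow> 'a::field \<Rightarrow> 'a" where
  "ff_trace p e x = (\<Sum>j<e. x ^ (p ^ j))"

definition prime_field_rep :: "nat \<Rightarrow> 'a::field \<Rightarrow> nat" where
  "prime_field_rep p y = (THE n. n < p \<and> of_nat n = y)"

definition add_char :: "nat \<Rightarrow> nat \<Rightarrow> 'a::field \<Rightarrow> complex" where
  "add_char p e x = exp (2 * pi * \<i> * of_nat (prime_field_rep p (ff_trace p e x)) / of_nat p)"

definition exp_sum :: "nat \<Rightarrow> nat \<Rightarrow> ('a::{field,finite} \<Rightarrow> 'a) \<Rightarrow> complex" where
  "exp_sum p e f = (\<Sum>x\<in>UNIV. add_char p e (f x))"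

text \<open>M_q = max over a,b in F_q^* of eps_{a x^3 + b x}.  These sums are real
  (the polynomial is odd), so the maximum is taken over the real parts.\<close>
definition M_q :: "nat \<Rightarrow> nat \<Rightarrow> 'a::{field,finite} itself \<Rightarrow> real" where
  "M_q p e TYPE('a) = Max {Re (exp_sum p e (\<lambda>x::'a. a * x ^ 3 + b * x)) | a b. a \<noteq> 0 \<and> b \<noteq> 0}"

text \<open>Vertices: vectors (a_1,...,a_k) in F_q^k, represented as functions nat => 'a
  which are 0 outside the index range {1..k}.\<close>
definition S_vertices :: "nat \<Rightarrow> (nat \<Rightarrow> 'a::zero) set" where
  "S_vertices k = {a. \<forall>i. (i < 1 \<or> k < i) \<longrightarrow> a i = 0}"

definition S_adj :: "nat \<Rightarrow> (nat \<Rightarrow> 'a \<Rightarrow> 'a) \<Rightarrow> (nat \<Rightarrow> 'a \<Rightarrow> 'a)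
    \<Rightarrow> (nat \<Rightarrow> 'a::field) \<Rightarrow> (nat \<Rightarrow> 'a) \<Rightarrow> bool" where
  "S_adj k f g a b \<longleftrightarrow> a \<in> S_vertices k \<and> b \<in> S_vertices k \<and> a 1 \<noteq> b 1 \<and>
     (\<forall>i\<in>{3..k}. b i - a i = g i (b 1 - a 1) * f i ((b 2 - a 2) / (b 1 - a 1)))"

definition connected_graph :: "'v set \<Rightarrow> ('v \<Rightarrow> 'v \<Rightarrow> bool) \<Rightarrow> bool" where
  "connected_graph V E \<longleftrightarrow> (\<forall>u\<in>V. \<forall>v\<in>V. E\<^sup>*\<^sup>* u v)"

text \<open>Adjacency matrix w.r.t. an (arbitrary, fixed) enumeration of the finite vertex set;
  its spectrum does not depend on the enumeration.\<close>
definition vertex_enum :: "'v set \<Rightarrow> nat \<Rightarrow> 'v" where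
  "vertex_enum V = (SOME h. bij_betw h {0..<card V} V)"

definition adj_matrix :: "'v set \<Rightarrow> ('v \<Rightarrow> 'v \<Rightarrow> bool) \<Rightarrow> real mat" where
  "adj_matrix V E = mat (card V) (card V)
     (\<lambda>(i,j). if E (vertex_enum V i) (vertex_enum V j) then 1 else 0)"

text \<open>Second largest adjacency eigenvalue (counted with multiplicity): the eigenvalues
  of the real symmetric adjacency matrix are the real roots of its characteristic
  polynomial (which splits over the reals), sorted in decreasing order.\<close>
definition lambda2 :: "'v set \<Rightarrow> ('v \<Rightarrow> 'v \<Rightarrow> bool) \<Rightarrow> real" where
  "lambda2 V E = rev (sorted_list_of_multiset (proots (char_poly (adj_matrix V E)))) ! 1"

end

theory Submission
  imports Defs "HOL-Algebra.Algebraic_Closure_Type" "HOL-Number_Theory.Residues"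
begin

text \<open>
  The graph is a Cayley graph of \<open>F_q^k\<close>, so its eigenvalues are the character sums \<open>\<lambda>_w\<close> over
  the connection set \<open>{(x, x t, x^3 t^p, x^3 t^(p^2), \<dots>)}\<close>. If \<open>w_2 \<noteq> 0\<close>, summing over \<open>x\<close> first
  gives sums \<open>\<epsilon>\<close> of cubic polynomials, of which only one has vanishing linear coefficient; if
  \<open>w_2 = 0\<close>, summing over \<open>t\<close> first counts the roots of a linearized polynomial in \<open>x^3\<close>, and
  \<open>x \<mapsto> x^3\<close> is a bijection since \<open>q \<equiv> 2 (mod 3)\<close>. Connectedness follows because every nontrivial
  \<open>\<lambda>_w\<close> is smaller than the degree.

  The bound \<open>2 sqrt q\<close> on cubic sums is proved in two steps. The method of Stepanov and Bombieri
  bounds the sum over \<open>F_Q\<close>, \<open>Q = p^(2 \<mu>)\<close>, by \<open>7 p sqrt Q\<close>: there is a nonzero polynomial of degree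
  at most \<open>Q / p + 7 sqrt Q\<close> vanishing wherever \<open>Tr (a x^3 + b x)\<close> has a given value. On the
  other hand, the sums \<open>\<epsilon>_m\<close> over \<open>F_{p^m}\<close> satisfy \<open>\<epsilon>_{2m} = 2 p^m - \<epsilon>_m^2\<close>, because every pair \<open>(s, t)\<close>
  in \<open>F_{p^m}\<close> is the sum and product of exactly two elements in total, counting the ordered pairs
  \<open>(x, y)\<close> in \<open>F_{p^m}\<close> and the pairs \<open>(x, x^(p^m))\<close> with \<open>x\<close> in \<open>F_{p^(2m)}\<close>. If \<open>\<bar>\<epsilon>_m\<bar>\<close> exceeded
  \<open>2 sqrt (p^m)\<close>, iterating this relation would contradict the weaker bound.
\<close>

hide_const (open) Polynomials.degree Polynomials.lead_coeff up_ring.coeff up_ring.monom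
  module.smult Divisibility.prime

section \<open>Additive characters in characteristic p\<close>

locale char_p_field =
  fixes p :: nat and K :: "'b::field itself"
  assumes prime_p: "prime p" and CHAR_p: "CHAR('b) = p"
begin

lemma p_gt_1: "1 < p"
  using prime_p prime_gt_1_nat by blast

lemma p_pos: "0 < p"
  using p_gt_1 by simp

section \<open>Frobenius powers and their fixed fields\<close>

lemma frob_add: "(x + y :: 'b) ^ (p ^ i) = x ^ (p ^ i) + y ^ (p ^ i)"
  using freshmans_dream'[where ?'a = 'b] prime_p CHAR_p by blast

lemma frob_sum: "(\<Sum>j\<in>A. f j :: 'b) ^ (p ^ i) = (\<Sum>j\<in>A. f j ^ (p ^ i))"
  using freshmans_dream_sum'[where ?'a = 'b] prime_p CHAR_p by blast

lemma frob_minus: "(- x :: 'b) ^ (p ^ i) = - (x ^ (p ^ i))"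
proof -
  have "x ^ (p ^ i) + (- x) ^ (p ^ i) = 0"
    using frob_add[of x "- x" i] p_pos by (simp add: zero_power)
  then show ?thesis by (metis add.inverse_unique)
qed

lemma frob_diff: "(x - y :: 'b) ^ (p ^ i) = x ^ (p ^ i) - y ^ (p ^ i)"
  using frob_add[of x "- y" i] by (simp add: frob_minus)

lemma frob_inj: "(x :: 'b) ^ (p ^ i) = y ^ (p ^ i) \<longleftrightarrow> x = y"
proof
  assume "x ^ (p ^ i) = y ^ (p ^ i)"
  then have "(x - y) ^ (p ^ i) = 0" by (simp add: frob_diff)
  then show "x = y" by simp
qed simp

lemma of_nat_inj_p: "(of_nat m :: 'b) = of_nat n \<longleftrightarrow> m mod p = n mod p"
  using of_nat_eq_iff_cong_CHAR[where ?'a = 'b] CHAR_p by (simp add: cong_def)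

text \<open>The fixed field of the m-th Frobenius power, kept as a set so that all fields of a tower
  share one type. In an algebraically closed field it has order \<open>p ^ m\<close> for
  \<open>m > 0\<close>; for \<open>m = 0\<close> it is the whole field.\<close>

definition Fx :: "nat \<Rightarrow> 'b set" where
  "Fx m = {x. x ^ (p ^ m) = x}"

lemma Fx_0: "0 \<in> Fx m" using p_pos by (simp add: Fx_def)
lemma Fx_1: "1 \<in> Fx m" by (simp add: Fx_def)
lemma Fx_add: "x \<in> Fx m \<Longrightarrow> y \<in> Fx m \<Longrightarrow> x + y \<in> Fx m" by (simp add: Fx_def frob_add)
lemma Fx_uminus: "x \<in> Fx m \<Longrightarrow> - x \<in> Fx m" by (simp add: Fx_def frob_minus)
lemma Fx_diff: "x \<in> Fx m \<Longrightarrow> y \<in> Fx m \<Longrightarrow> x - y \<in> Fx m" by (simp add: Fx_def frob_diff)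
lemma Fx_mult: "x \<in> Fx m \<Longrightarrow> y \<in> Fx m \<Longrightarrow> x * y \<in> Fx m" by (simp add: Fx_def power_mult_distrib)
lemma Fx_power: "x \<in> Fx m \<Longrightarrow> x ^ n \<in> Fx m" by (simp add: Fx_def) (metis power_mult mult.commute)
lemma Fx_inverse: "x \<in> Fx m \<Longrightarrow> inverse x \<in> Fx m" by (simp add: Fx_def power_inverse)
lemma Fx_of_nat: "of_nat n \<in> Fx m"
  by (induction n) (simp_all add: Fx_0 Fx_1 Fx_add)

lemmas Fx_intros = Fx_0 Fx_1 Fx_add Fx_uminus Fx_diff Fx_mult Fx_power Fx_of_nat

lemma poly_frob_roots:
  assumes "m > 0"
  shows "Fx m = {x. poly (monom 1 (p ^ m) - monom 1 1) x = 0}"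
    and "degree (monom 1 (p ^ m) - monom 1 1 :: 'b poly) = p ^ m"
    and "(monom 1 (p ^ m) - monom 1 1 :: 'b poly) \<noteq> 0"
proof -
  have gt: "1 < p ^ m" using assms p_gt_1 by (metis one_less_power)
  show "Fx m = {x. poly (monom 1 (p ^ m) - monom 1 1) x = 0}"
    by (auto simp: Fx_def poly_monom)
  show d: "degree (monom 1 (p ^ m) - monom 1 1 :: 'b poly) = p ^ m"
    using gt degree_add_eq_left[of "- monom 1 1 :: 'b poly" "monom 1 (p ^ m)"]
    by (simp add: degree_monom_eq)
  show "(monom 1 (p ^ m) - monom 1 1 :: 'b poly) \<noteq> 0"
    using d gt by (metis degree_0 not_one_less_zero)
qed

lemma finite_Fx: "m > 0 \<Longrightarrow> finite (Fx m)"
  using poly_roots_finite poly_frob_roots(1,3) by metis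

lemma card_Fx_le: "m > 0 \<Longrightarrow> card (Fx m) \<le> p ^ m"
  using card_poly_roots_bound poly_frob_roots by metis

text \<open>The polynomial \<open>x ^ p - x\<close> has at most p roots, and the images of the
  naturals below p are p distinct ones.\<close>

lemma Fx_prime: "Fx 1 = of_nat ` {..<p}"
proof -
  have "inj_on (of_nat :: nat \<Rightarrow> 'b) {..<p}"
    by (auto simp: inj_on_def of_nat_inj_p)
  then have "card (of_nat ` {..<p} :: 'b set) = p" by (simp add: card_image)
  then show ?thesis
    using card_seteq[of "Fx 1" "of_nat ` {..<p}"] finite_Fx[of 1] card_Fx_le[of 1] Fx_of_nat[of _ 1] by auto
qed

lemma prime_field_rep:
  assumes "y \<in> Fx 1"
  shows "prime_field_rep p y < p" "of_nat (prime_field_rep p y) = (y :: 'b)"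
proof -
  obtain n where n: "n < p" "of_nat n = y" using assms Fx_prime by auto
  have "\<exists>!n. n < p \<and> of_nat n = y"
    by (rule ex1I[of _ n]) (use n in \<open>auto simp: of_nat_inj_p\<close>)
  from theI'[OF this] show "prime_field_rep p y < p" "of_nat (prime_field_rep p y) = y"
    unfolding prime_field_rep_def by auto
qed

section \<open>The trace and the additive character\<close>

lemma ff_trace_add: "ff_trace p m (x + y :: 'b) = ff_trace p m x + ff_trace p m y"
  by (simp add: ff_trace_def frob_add sum.distrib)

lemma ff_trace_0: "ff_trace p m (0 :: 'b) = 0"
  using p_pos by (simp add: ff_trace_def zero_power)

text \<open>Frobenius shifts the conjugates cyclically: the new last one,
  \<open>x ^ (p ^ m)\<close>, equals the dropped first one.\<close>

lemma ff_trace_frob: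
  assumes "x \<in> Fx m"
  shows "ff_trace p m (x ^ p) = ff_trace p m x"
proof (cases m)
  case (Suc n)
  have "ff_trace p m (x ^ p) = (\<Sum>j<m. x ^ (p ^ Suc j))"
    by (simp add: ff_trace_def flip: power_mult)
  also have "\<dots> = (\<Sum>j<n. x ^ (p ^ Suc j)) + x ^ (p ^ m)" using Suc by simp
  also have "x ^ (p ^ m) = x ^ (p ^ 0)" using assms by (simp add: Fx_def)
  also have "(\<Sum>j<n. x ^ (p ^ Suc j)) + x ^ (p ^ 0) = ff_trace p m x"
    unfolding ff_trace_def Suc sum.lessThan_Suc_shift[of _ n] by simp
  finally show ?thesis .
qed (simp add: ff_trace_def)

lemma ff_trace_in_prime:
  assumes "x \<in> Fx m"
  shows "ff_trace p m x \<in> Fx 1"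
proof -
  have "ff_trace p m x ^ (p ^ 1) = ff_trace p m (x ^ p)"
    unfolding ff_trace_def frob_sum by (simp add: mult.commute flip: power_mult)
  then show ?thesis using ff_trace_frob[OF assms] by (simp add: Fx_def)
qed

definition root_unity :: "nat \<Rightarrow> complex" where
  "root_unity n = exp (2 * pi * \<i> * of_nat n / of_nat p)"

lemma root_unity_add: "root_unity (m + n) = root_unity m * root_unity n"
  by (simp add: root_unity_def exp_add [symmetric] add_divide_distrib [symmetric] algebra_simps)

lemma root_unity_multiple: "root_unity (p * n) = 1"
proof -
  have "2 * pi * \<i> * of_nat (p * n) / of_nat p = of_nat n * (of_real (2 * pi) * \<i>)"
    using p_pos by simp
  then show ?thesis by (simp add: root_unity_def exp_of_nat_mult)
qed

lemma root_unity_mod: "root_unity (n mod p) = root_unity n"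
  by (metis mult_div_mod_eq root_unity_add root_unity_multiple mult_1)

lemma root_unity_cis: "root_unity n = cis (2 * pi * real n / real p)"
  by (simp add: root_unity_def cis_conv_exp mult_ac)

lemma root_unity_eq_1_iff: "root_unity n = 1 \<longleftrightarrow> p dvd n"
proof -
  have "root_unity n = 1 \<longleftrightarrow> root_unity (n mod p) = root_unity 0"
    by (simp add: root_unity_mod) (simp add: root_unity_def)
  also have "\<dots> \<longleftrightarrow> n mod p = 0"
    using bij_betw_roots_unity[OF p_pos] p_pos
    by (auto simp: bij_betw_def inj_on_def root_unity_cis)
  finally show ?thesis by (simp add: dvd_eq_mod_eq_0)
qed

lemma norm_root_unity: "cmod (root_unity n) = 1"
  by (simp add: root_unity_def)

text \<open>Any natural number that reduces to the trace may replace the least one, which removes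
  the definite description.\<close>

lemma add_char_root_unity:
  assumes "x \<in> Fx m" and "of_nat n = ff_trace p m x"
  shows "add_char p m x = root_unity n"
proof -
  let ?r = "prime_field_rep p (ff_trace p m x)"
  have "of_nat ?r = (of_nat n :: 'b)" "?r < p"
    using prime_field_rep[OF ff_trace_in_prime[OF assms(1)]] assms(2) by auto
  then have "?r = n mod p" using of_nat_inj_p by simp
  then have "add_char p m x = root_unity (n mod p)" by (simp add: add_char_def root_unity_def)
  then show ?thesis by (simp add: root_unity_mod)
qed

lemma ff_trace_of_nat:
  assumes "x \<in> Fx m"
  obtains n where "of_nat n = ff_trace p m x"
  using prime_field_rep[OF ff_trace_in_prime[OF assms]] by blast

lemma add_char_add:
  assumes "x \<in> Fx m" "y \<in> Fx m"
  shows "add_char p m (x + y) = add_char p m x * add_char p m y"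
proof -
  obtain a b where "of_nat a = ff_trace p m x" "of_nat b = ff_trace p m y"
    using ff_trace_of_nat assms by metis
  then show ?thesis
    using add_char_root_unity[of "x + y" m "a + b"] add_char_root_unity[of x m a]
      add_char_root_unity[of y m b] assms
    by (simp add: Fx_add ff_trace_add root_unity_add)
qed

lemma add_char_0: "add_char p m (0::'b) = 1"
  using add_char_root_unity[of 0 m 0] by (simp add: Fx_0 ff_trace_0 root_unity_def)

lemma norm_add_char: "cmod (add_char p m (x::'b)) = 1"
  by (simp add: add_char_def)

lemma add_char_uminus:
  assumes "x \<in> Fx m"
  shows "add_char p m (- x) = cnj (add_char p m x)"
proof -
  have "add_char p m x * add_char p m (- x) = 1"
    using add_char_add[OF assms Fx_uminus[OF assms]] add_char_0 by simp
  moreover have "add_char p m x * cnj (add_char p m x) = 1"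
    by (simp add: complex_norm_square [symmetric] norm_add_char)
  moreover have "add_char p m x \<noteq> 0" using norm_add_char[of m x] by auto
  ultimately show ?thesis by (metis mult_left_cancel)
qed

lemma add_char_eq_1_iff:
  assumes "x \<in> Fx m"
  shows "add_char p m x = 1 \<longleftrightarrow> ff_trace p m x = 0"
proof -
  obtain a where a: "of_nat a = ff_trace p m x" using ff_trace_of_nat assms by metis
  then have "ff_trace p m x = 0 \<longleftrightarrow> p dvd a"
    using of_nat_inj_p[of a 0] by (auto simp: dvd_eq_mod_eq_0)
  then show ?thesis using add_char_root_unity[OF assms a] root_unity_eq_1_iff by simp
qed

lemma add_char_frob:
  assumes "x \<in> Fx m"
  shows "add_char p m (x ^ (p ^ i)) = add_char p m x"
proof (induction i)
  case (Suc i)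
  have "ff_trace p m (x ^ (p ^ Suc i)) = ff_trace p m (x ^ (p ^ i))"
    using ff_trace_frob[OF Fx_power[OF assms, of "p ^ i"]] by (simp add: mult.commute flip: power_mult)
  then show ?case using Suc by (simp add: add_char_def)
qed simp

lemma add_char_sum:
  assumes "\<And>i. i \<in> A \<Longrightarrow> f i \<in> Fx m"
  shows "(\<Sum>i\<in>A. f i) \<in> Fx m" and "add_char p m (\<Sum>i\<in>A. f i) = (\<Prod>i\<in>A. add_char p m (f i))"
  using assms
  by (induction A rule: infinite_finite_induct) (auto simp: Fx_0 Fx_add add_char_0 add_char_add)

text \<open>As a polynomial the trace is nonzero of degree at most \<open>p ^ (m - 1)\<close>, so it
  cannot vanish at \<open>p ^ m\<close> elements.\<close>

lemma add_char_nontrivial: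
  assumes "m > 0" and "card (Fx m) = p ^ m"
  shows "\<exists>x\<in>Fx m. add_char p m x \<noteq> 1"
proof (rule ccontr)
  assume "\<not> ?thesis"
  then have *: "Fx m \<subseteq> {x. ff_trace p m x = 0}" using add_char_eq_1_iff by auto
  define P :: "'b poly" where "P = (\<Sum>j<m. monom 1 (p ^ j))"
  have P: "poly P x = ff_trace p m x" for x by (simp add: P_def ff_trace_def poly_sum poly_monom)
  have deg: "degree P \<le> p ^ (m - 1)"
    unfolding P_def
    by (rule degree_sum_le) (use p_gt_1 in \<open>auto intro!: order.trans[OF degree_monom_le] power_increasing\<close>)
  have "coeff P (p ^ 0) = (\<Sum>j<m. if j = 0 then 1 else 0)"
    unfolding P_def coeff_sum
    by (rule sum.cong) (use p_gt_1 in \<open>auto\<close>)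
  also have "\<dots> = 1" using assms(1) by simp
  finally have "P \<noteq> 0" by auto
  then have "card {x. poly P x = 0} \<le> p ^ (m - 1)" "finite {x. poly P x = 0}"
    using card_poly_roots_bound[of P] deg poly_roots_finite[of P] by auto
  then have "p ^ m \<le> p ^ (m - 1)"
    using card_mono[of "{x. poly P x = 0}" "Fx m"] * assms(2) by (simp add: P)
  then show False using assms(1) p_gt_1 by simp
qed

text \<open>For nonzero c, translating x by d multiplies the sum by
  \<open>add_char p m (c * d)\<close>, and d is chosen so that this factor is not 1.\<close>

lemma sum_add_char_mult:
  assumes "m > 0" and "card (Fx m) = p ^ m" and "c \<in> Fx m"
  shows "(\<Sum>x\<in>Fx m. add_char p m (c * x)) = (if c = 0 then of_nat (p ^ m) else 0)"
proof (cases "c = 0")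
  case False
  obtain z where z: "z \<in> Fx m" "add_char p m z \<noteq> 1" using add_char_nontrivial assms by blast
  define d where "d = inverse c * z"
  have d: "d \<in> Fx m" "c * d = z" using False assms z by (auto simp: d_def Fx_mult Fx_inverse)
  have "(\<Sum>x\<in>Fx m. add_char p m (c * x)) = (\<Sum>x\<in>Fx m. add_char p m (c * (x + d)))"
    by (rule sum.reindex_bij_witness[of _ "\<lambda>x. x + d" "\<lambda>x. x - d"]) (auto simp: d Fx_add Fx_diff)
  also have "\<dots> = (\<Sum>x\<in>Fx m. add_char p m (c * x) * add_char p m z)"
    by (rule sum.cong) (auto simp: distrib_left d add_char_add Fx_mult assms z)
  also have "\<dots> = (\<Sum>x\<in>Fx m. add_char p m (c * x)) * add_char p m z"
    by (rule sum_distrib_right [symmetric])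
  finally show ?thesis using z(2) False by simp
qed (simp add: add_char_0 assms)

end

section \<open>Stepanov's method for cubic polynomials\<close>

lemma homogeneous_system:
  fixes A :: "'i \<Rightarrow> nat \<Rightarrow> 'f::field"
  assumes "finite I" and "n < card I"
  obtains c i where "i \<in> I" "c i \<noteq> 0" "\<And>k. k < n \<Longrightarrow> (\<Sum>i\<in>I. c i * A i k) = 0"
proof -
  have "\<exists>c. (\<exists>i\<in>I. c i \<noteq> 0) \<and> (\<forall>k<n. (\<Sum>i\<in>I. c i * A i k) = 0)"
    using assms
  proof (induction n arbitrary: I A)
    case 0
    then have "I \<noteq> {}" by auto
    then show ?case by (intro exI[of _ "\<lambda>_. 1"]) auto
  next
    case (Suc n)
    show ?case
    proof (cases "\<forall>i\<in>I. A i n = 0")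
      case True
      have "n < card I" using Suc.prems by simp
      from Suc.IH[OF Suc.prems(1) this, of A] obtain c
        where c: "\<exists>i\<in>I. c i \<noteq> 0" "\<forall>k<n. (\<Sum>i\<in>I. c i * A i k) = 0" by blast
      have "(\<Sum>i\<in>I. c i * A i n) = 0" using True by simp
      then show ?thesis using c by (auto simp: less_Suc_eq)
    next
      case False
      then obtain i0 where i0: "i0 \<in> I" "A i0 n \<noteq> 0" by blast
      define J where "J = I - {i0}"
      \<comment> \<open>Gaussian elimination: equation n is solved for the unknown
        \<open>i0\<close>, and B is the system left for the other unknowns. The value
        \<open>- t\<close> assigned to \<open>i0\<close> below makes equation n hold.\<close>
      define B where "B = (\<lambda>i k. A i k - A i n / A i0 n * A i0 k)"
      have I: "I = insert i0 J" "i0 \<notin> J" "finite J" using i0 Suc.prems(1) by (auto simp: J_def)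
      then have "n < card J" using Suc.prems(2) by simp
      from Suc.IH[OF I(3) this, of B] obtain c
        where c: "\<exists>i\<in>J. c i \<noteq> 0" "\<forall>k<n. (\<Sum>i\<in>J. c i * B i k) = 0" by blast
      define t where "t = (\<Sum>i\<in>J. c i * A i n) / A i0 n"
      define d where "d = c(i0 := - t)"
      have d: "(\<Sum>i\<in>I. d i * A i k) = (\<Sum>i\<in>J. c i * A i k) - t * A i0 k" for k
      proof -
        have "(\<Sum>i\<in>J. d i * A i k) = (\<Sum>i\<in>J. c i * A i k)"
          by (rule sum.cong) (use I in \<open>auto simp: d_def\<close>)
        then show ?thesis using I by (simp add: d_def)
      qed
      have B: "(\<Sum>i\<in>J. c i * B i k) = (\<Sum>i\<in>J. c i * A i k) - t * A i0 k" for k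
      proof -
        have "t * A i0 k = (\<Sum>i\<in>J. c i * (A i n / A i0 n * A i0 k))"
          by (simp add: t_def sum_divide_distrib sum_distrib_right mult.assoc)
        then show ?thesis by (simp add: B_def right_diff_distrib sum_subtractf)
      qed
      have "(\<Sum>i\<in>I. d i * A i n) = 0" unfolding d using i0 by (simp add: t_def)
      moreover have "\<forall>k<n. (\<Sum>i\<in>I. d i * A i k) = 0" using c(2) by (simp add: d B)
      moreover have "\<exists>i\<in>I. d i \<noteq> 0" using c(1) I by (auto simp: d_def)
      ultimately show ?thesis by (intro exI[of _ d]) (auto simp: less_Suc_eq)
    qed
  qed
  then show ?thesis using that by blast
qed

lemma poly_linear_dependence:
  fixes h :: "'i \<Rightarrow> 'f::field poly"
  assumes "finite I" and "n < card I" and "\<And>i. i \<in> I \<Longrightarrow> degree (h i) < n"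
  obtains c i where "i \<in> I" "c i \<noteq> 0" "(\<Sum>i\<in>I. smult (c i) (h i)) = 0"
proof -
  obtain c i where c: "i \<in> I" "c i \<noteq> 0"
    "\<And>k. k < n \<Longrightarrow> (\<Sum>i\<in>I. c i * coeff (h i) k) = 0"
    using homogeneous_system[OF assms(1,2), of "\<lambda>i k. coeff (h i) k"] by metis
  have "(\<Sum>i\<in>I. smult (c i) (h i)) = 0"
  proof (rule poly_eqI)
    fix k
    show "coeff (\<Sum>i\<in>I. smult (c i) (h i)) k = coeff 0 k"
    proof (cases "k < n")
      case False
      then have "coeff (h i) k = 0" if "i \<in> I" for i
        using assms(3)[OF that] by (intro coeff_eq_0) simp
      then show ?thesis by (simp add: coeff_sum)
    qed (simp add: coeff_sum c)
  qed
  then show ?thesis using that c by blast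
qed

text \<open>The term of largest degree among those with nonzero coefficient cannot be
  cancelled.\<close>

lemma distinct_degrees_sum_nonzero:
  fixes h :: "'i \<Rightarrow> 'f::field poly"
  assumes "finite I" and "\<And>i. i \<in> I \<Longrightarrow> h i \<noteq> 0" and "inj_on (\<lambda>i. degree (h i)) I"
    and "i0 \<in> I" "c i0 \<noteq> 0"
  shows "(\<Sum>i\<in>I. smult (c i) (h i)) \<noteq> 0"
proof
  assume eq: "(\<Sum>i\<in>I. smult (c i) (h i)) = 0"
  define J where "J = {i \<in> I. c i \<noteq> 0}"
  have "finite J" "J \<noteq> {}" using assms by (auto simp: J_def)
  then obtain m where m: "m \<in> J" "\<And>i. i \<in> J \<Longrightarrow> degree (h i) \<le> degree (h m)"
    using obtains_MAX[of J "\<lambda>i. degree (h i)"] by (metis Max_ge finite_imageI imageI)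
  have mI: "m \<in> I" "c m \<noteq> 0" using m by (auto simp: J_def)
  have "c i * coeff (h i) (degree (h m)) = 0" if "i \<in> I - {m}" for i
  proof (cases "c i = 0")
    case False
    then have "degree (h i) \<le> degree (h m)" using m that by (auto simp: J_def)
    moreover have "degree (h i) \<noteq> degree (h m)"
      using assms(3) that mI by (auto simp: inj_on_def)
    ultimately show ?thesis by (simp add: coeff_eq_0)
  qed simp
  then have "coeff (\<Sum>i\<in>I. smult (c i) (h i)) (degree (h m)) = c m * coeff (h m) (degree (h m))"
    using assms(1) mI by (simp add: coeff_sum sum.remove[of I m] sum.neutral)
  then show False using eq mI assms(2)[of m] by simp
qed

lemma sum_lessThan_add: "(\<Sum>i<m + n. f i) = (\<Sum>i<m. f i) + (\<Sum>i<n. f (m + i))"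
  for f :: "nat \<Rightarrow> 'a::comm_monoid_add"
  by (induction n) (simp_all add: add.assoc)

section \<open>Level sets of the trace of a cubic polynomial\<close>

locale alg_closed_char_p = char_p_field p K for p and K :: "'b::alg_closed_field itself"
begin

text \<open>The polynomial \<open>P = x ^ (p ^ m) - x\<close> splits, and a double root would also
  be a root of its derivative, which is the constant -1.\<close>

lemma card_Fx:
  assumes "m > 0"
  shows "card (Fx m) = p ^ m"
proof -
  define P :: "'b poly" where "P = monom 1 (p ^ m) - monom 1 1"
  note P = poly_frob_roots[OF assms, folded P_def]
  obtain A where A: "size A = p ^ m" "P = smult (lead_coeff P) (\<Prod>x\<in>#A. [:- x, 1:])"
    using alg_closed_imp_factorization[OF P(3)] P(2) by auto
  have "(of_nat (p ^ m) :: 'b) = 0"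
    using CHAR_p of_nat_CHAR[where ?'a = 'b] assms by (simp add: zero_power)
  then have dP: "pderiv P = - 1"
    unfolding P_def pderiv_diff pderiv_monom using assms by (simp add: monom_0 one_pCons zero_power)
  have "count A x \<le> 1" for x
  proof (rule ccontr)
    assume "\<not> ?thesis"
    then have "count A x \<ge> 2" by simp
    then have "{#x, x#} \<subseteq># A"
      by (auto simp: subseteq_mset_def)
    then obtain B where "A = {#x, x#} + B" by (auto simp: mset_subset_eq_exists_conv)
    then have "P = [:- x, 1:] * ([:- x, 1:] * smult (lead_coeff P) (\<Prod>x\<in>#B. [:- x, 1:]))"
      using A(2) by simp
    then obtain R where "P = [:- x, 1:] * ([:- x, 1:] * R)" by blast
    moreover have "poly (pderiv (L * (L * R))) x = 0" if "poly L x = 0" for L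
      by (simp add: pderiv_mult that)
    ultimately have "poly (pderiv P) x = 0" by (metis add.commute add_uminus_conv_diff diff_self mult.right_neutral poly_pCons poly_0 mult_zero_right add_0_right)
    then show False by (simp add: dP)
  qed
  then have "A = mset_set (set_mset A)"
    by (intro multiset_eqI) (auto simp: count_mset_set' count_eq_zero_iff intro!: le_antisym)
  moreover have "set_mset A = Fx m"
  proof -
    have "poly P x = 0 \<longleftrightarrow> x \<in># A" for x
    proof -
      have "poly P x = lead_coeff P * (\<Prod>y\<in>#A. x - y)"
        by (subst A(2)) (simp add: poly_prod_mset image_mset.compositionality o_def)
      then show ?thesis using P(3) by (auto simp: prod_mset_zero_iff)
    qed
    then show ?thesis using P(1) by auto
  qed
  ultimately show ?thesis using A(1) by (metis size_mset_set)
qed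

definition cubic_level :: "nat \<Rightarrow> 'b \<Rightarrow> 'b \<Rightarrow> 'b \<Rightarrow> 'b set" where
  "cubic_level m a b \<beta> = {x \<in> Fx m. ff_trace p m (a * x ^ 3 + b * x) = \<beta>}"

lemma card_cubic_level_le:
  assumes "a \<noteq> 0" and "p \<noteq> 3" and "\<mu> > 0"
  shows "card (cubic_level (2 * \<mu>) a b \<beta>) \<le> p ^ (2 * \<mu> - 1) + 7 * p ^ \<mu>"
proof -
  define s where "s = p ^ (\<mu> - 1)"
  define r where "r = p ^ \<mu>"
  have s1: "1 \<le> s" using p_pos by (simp add: s_def)
  have r: "r = p * s" using assms(3) by (simp add: r_def s_def power_eq_if)
  have r0: "r > 0" using p_pos by (simp add: r_def)
  have rs: "p ^ (2 * \<mu> - 1) = r * s"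
    using assms(3) by (simp add: r_def s_def mult_2 flip: power_add)
  define f where "f = monom a 3 + monom b 1"
  have deg_f: "degree f = 3"
    unfolding f_def using assms(1) degree_monom_le[of b 1]
    by (subst degree_add_eq_left) (simp_all add: degree_monom_eq)
  then have f0: "f \<noteq> 0" by auto
  \<comment> \<open>T is the first half of the trace of f. Its r-th power is the second half, so on
    the level set the values satisfy \<open>T + T ^ r = \<beta>\<close>.\<close>
  define T where "T = (\<Sum>i<\<mu>. f ^ (p ^ i))"
  have deg_T: "degree T = 3 * s"
  proof -
    obtain \<nu> where \<nu>: "\<mu> = Suc \<nu>" using assms(3) gr0_conv_Suc by auto
    have T: "T = (\<Sum>i<\<nu>. f ^ (p ^ i)) + f ^ (p ^ \<nu>)" by (simp add: T_def \<nu>)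
    have deg: "degree (f ^ (p ^ i)) = 3 * p ^ i" for i
      using f0 deg_f by (simp add: degree_power_eq)
    have "degree (\<Sum>i<\<nu>. f ^ (p ^ i)) < 3 * p ^ \<nu>"
      by (rule degree_sum_less) (use p_gt_1 in \<open>auto simp: deg\<close>)
    then show ?thesis unfolding T by (subst degree_add_eq_right) (auto simp: deg s_def \<nu>)
  qed
  then have T0: "T \<noteq> 0" using s1 by auto
  define U where "U = [:\<beta>:] - T"
  have deg_U: "degree U \<le> 3 * s"
    unfolding U_def using deg_T by (intro degree_diff_le) auto
  txt \<open>On the level set, \<open>x^(r^2) = x\<close> and \<open>T(x)^r = U(x)\<close>, so the \<open>r\<close>-th power of the auxiliary polynomial
    \<open>g = \<Sum> c_(l,i,j) x^(l + r i) T^j\<close> agrees there with \<open>\<Sum> c_(l,i,j)^r x^(r l + i) U^j\<close>, and linear algebra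
    makes the latter identically zero. The monomials of \<open>g\<close> have distinct degrees, so \<open>g \<noteq> 0\<close>.\<close>
  define I where "I = {..<s} \<times> {..<s+5} \<times> {..<p}"
  have fin: "finite I" by (simp add: I_def)
  have card: "card I = r * (s + 5)" by (simp add: I_def card_cartesian_product r)
  obtain s' p' where sp: "s = Suc s'" "p = Suc p'"
    using s1 p_pos by (metis Suc_le_D One_nat_def gr0_conv_Suc)
  define h where "h = (\<lambda>(l, i, j). monom 1 (r * l + i) * U ^ j)"
  have deg_h: "degree (h t) < r * s + 2 * r + 5" if "t \<in> I" for t
  proof -
    obtain l i j where t1: "t = (l, i, j)" by (metis prod_cases3)
    then have t: "t = (l, i, j)" "l \<le> s'" "i \<le> s + 4" "j \<le> p'"
      using that sp by (auto simp: I_def)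
    have "degree (h t) \<le> degree (monom (1::'b) (r * l + i)) + degree (U ^ j)"
      unfolding t(1) h_def split by (rule degree_mult_le)
    also have "\<dots> \<le> (r * l + i) + 3 * s * j"
      by (rule add_mono[OF degree_monom_le order.trans[OF degree_power_le mult_right_mono[OF deg_U]]]) simp
    also have "\<dots> \<le> (r * s' + (s + 4)) + 3 * s * p'"
      using t by (intro add_mono mult_mono) auto
    also have "\<dots> < r * s + 2 * r + 5"
      unfolding r sp by (simp add: algebra_simps)
    finally show ?thesis .
  qed
  \<comment> \<open>This is where the 5 in the range of i comes from: there are
    \<open>r * s + 5 * r\<close> unknowns, and \<open>5 * r\<close> exceeds \<open>2 * r + 5\<close>
    because \<open>r \<ge> 2\<close>.\<close>
  have card_I: "r * s + 2 * r + 5 < card I"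
  proof -
    have "2 * 1 \<le> p * s" using p_gt_1 s1 by (intro mult_le_mono) auto
    then show ?thesis by (simp add: card r algebra_simps)
  qed
  obtain C t0 where C: "t0 \<in> I" "C t0 \<noteq> 0" "(\<Sum>t\<in>I. smult (C t) (h t)) = 0"
    by (rule poly_linear_dependence[OF fin card_I deg_h])
  \<comment> \<open>The vanishing condition is linear only in the r-th powers of the coefficients of
    g. The solution C therefore prescribes these powers, and algebraic closedness supplies the
    roots.\<close>
  have "\<forall>t. \<exists>c. c ^ r = C t" using nth_root_exists[OF r0] by blast
  then obtain c where c: "\<And>t. c t ^ r = C t" by metis
  define G where "G = (\<lambda>(l, i, j). monom 1 (l + r * i) * T ^ j)"
  have G0: "G t \<noteq> 0" for t using T0 by (cases t) (simp add: G_def monom_eq_0_iff)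
  have deg_G: "degree (G (l, i, j)) = l + s * (p * i + 3 * j)" for l i j
    using T0 by (simp add: G_def degree_mult_eq monom_eq_0_iff degree_monom_eq degree_power_eq deg_T r algebra_simps)
  \<comment> \<open>The degree is \<open>l + s * (p * i + 3 * j)\<close>. Its remainder modulo s
    gives l; the quotient modulo p gives j, as 3 is invertible there and \<open>j < p\<close>; then
    i follows.\<close>
  have "inj_on (\<lambda>t. degree (G t)) I"
  proof (rule inj_onI)
    fix t t' assume tI: "t \<in> I" "t' \<in> I" and eq: "degree (G t) = degree (G t')"
    obtain l i j l' i' j' where t: "t = (l, i, j)" "t' = (l', i', j')"
      by (metis prod_cases3)
    have lt: "l < s" "l' < s" "j < p" "j' < p" using tI t by (auto simp: I_def)
    have eq: "l + s * (p * i + 3 * j) = l' + s * (p * i' + 3 * j')" using eq by (simp add: t deg_G)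
    have "l = l'" using arg_cong[OF eq, of "\<lambda>x. x mod s"] lt by simp
    moreover have eq2: "p * i + 3 * j = p * i' + 3 * j'"
      using arg_cong[OF eq, of "\<lambda>x. x div s"] lt s1 by simp
    moreover have "j = j'"
    proof -
      have "\<not> p dvd 3"
      proof
        assume dvd: "p dvd 3"
        then have "p = 2" using dvd_imp_le[of p 3] p_gt_1 assms(2) by auto
        then show False using dvd by simp
      qed
      then have "coprime 3 p" using prime_p by (metis prime_imp_coprime coprime_commute)
      moreover have "[3 * j = 3 * j'] (mod p)"
        using arg_cong[OF eq2, of "\<lambda>x. x mod p"] by (simp add: cong_def)
      ultimately have "[j = j'] (mod p)" by (simp add: cong_mult_lcancel_nat)
      then show ?thesis using lt by (simp add: cong_def)
    qed
    ultimately show "t = t'" using p_pos by (simp add: t)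
  qed
  define g where "g = (\<Sum>t\<in>I. smult (c t) (G t))"
  have "c t0 \<noteq> 0" using c[of t0] C(2) r0 by (auto simp: zero_power)
  then have g0: "g \<noteq> 0"
    unfolding g_def using distinct_degrees_sum_nonzero[OF fin G0 \<open>inj_on _ I\<close> C(1)] by blast
  \<comment> \<open>Beyond \<open>r * s\<close>, the bound \<open>i \<le> s + 4\<close> costs
    \<open>4 * r\<close> and \<open>j < p\<close> costs less than \<open>3 * r\<close>, hence the
    7.\<close>
  have deg_g: "degree g \<le> r * s + 7 * r"
    unfolding g_def
  proof (rule degree_sum_le[OF fin])
    fix t assume tI: "t \<in> I"
    obtain l i j where t1: "t = (l, i, j)" by (metis prod_cases3)
    then have t: "t = (l, i, j)" "l \<le> s'" "i \<le> s + 4" "j \<le> p'"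
      using tI sp by (auto simp: I_def)
    have "degree (smult (c t) (G t)) \<le> l + s * (p * i + 3 * j)"
      unfolding t(1) deg_G [symmetric] by (rule degree_smult_le)
    also have "\<dots> \<le> s' + s * (p * (s + 4) + 3 * p')"
      using t by (intro add_mono mult_mono) auto
    also have "\<dots> \<le> r * s + 7 * r"
      unfolding r sp by (simp add: algebra_simps)
    finally show "degree (smult (c t) (G t)) \<le> r * s + 7 * r" .
  qed
  have "poly g x = 0" if x: "x \<in> cubic_level (2 * \<mu>) a b \<beta>" for x
  proof -
    have xr: "x ^ (r * r) = x"
      using x by (simp add: cubic_level_def Fx_def r_def mult_2 power_add)
    have fx: "poly f x = a * x ^ 3 + b * x" by (simp add: f_def poly_monom)
    have Tx: "poly T x = (\<Sum>i<\<mu>. poly f x ^ (p ^ i))" by (simp add: T_def poly_sum)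
    have "\<beta> = (\<Sum>i<\<mu> + \<mu>. poly f x ^ (p ^ i))"
      using x by (simp add: cubic_level_def ff_trace_def fx mult_2)
    also have "\<dots> = poly T x + (\<Sum>i<\<mu>. poly f x ^ (p ^ (\<mu> + i)))"
      by (simp only: Tx sum_lessThan_add)
    also have "(\<Sum>i<\<mu>. poly f x ^ (p ^ (\<mu> + i))) = poly T x ^ r"
      unfolding r_def Tx frob_sum by (simp only: power_add power_mult [symmetric] mult.commute)
    finally have Tr: "poly T x ^ r = poly U x" by (simp add: U_def)
    have hG: "poly (G t) x ^ r = poly (h t) x" for t
    proof (cases t)
      case (fields l i j)
      have "(l + r * i) * r = r * l + (r * r) * i" by (simp add: algebra_simps)
      then have "(x ^ (l + r * i)) ^ r = x ^ (r * l) * (x ^ (r * r)) ^ i"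
        by (simp only: power_mult [symmetric] power_add [symmetric])
      moreover have "(poly T x ^ j) ^ r = (poly T x ^ r) ^ j"
        by (simp only: power_mult [symmetric] mult.commute)
      ultimately have "(x ^ (l + r * i) * poly T x ^ j) ^ r = x ^ (r * l + i) * poly U x ^ j"
        by (simp only: power_mult_distrib xr Tr power_add)
      then show ?thesis by (simp add: fields G_def h_def poly_monom)
    qed
    have "poly g x ^ r = (\<Sum>t\<in>I. (c t * poly (G t) x) ^ r)"
      unfolding g_def r_def by (simp add: poly_sum frob_sum)
    also have "\<dots> = (\<Sum>t\<in>I. C t * poly (h t) x)"
      by (simp add: power_mult_distrib c hG)
    also have "\<dots> = poly (\<Sum>t\<in>I. smult (C t) (h t)) x" by (simp add: poly_sum)
    finally have "poly g x ^ r = 0" by (simp add: C)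
    then show ?thesis by simp
  qed
  then have "cubic_level (2 * \<mu>) a b \<beta> \<subseteq> {x. poly g x = 0}" by blast
  then have "card (cubic_level (2 * \<mu>) a b \<beta>) \<le> degree g"
    by (rule order.trans[OF card_mono[OF poly_roots_finite[OF g0]] card_poly_roots_bound[OF g0]])
  then show ?thesis using deg_g rs r_def by simp
qed

definition cubic_sum :: "nat \<Rightarrow> 'b \<Rightarrow> 'b \<Rightarrow> complex" where
  "cubic_sum m a b = (\<Sum>x\<in>Fx m. add_char p m (a * x ^ 3 + b * x))"

text \<open>Since the p-th roots of unity sum to 0, the common upper bound B can be subtracted from
  every level count. All differences then have one sign, so their absolute values add up to
  \<open>p * B - p ^ m\<close>, which is the claimed bound.\<close>

lemma norm_cubic_sum_le:
  assumes "a \<noteq> 0" and "p \<noteq> 3" and "\<mu> > 0" and ab: "a \<in> Fx (2 * \<mu>)" "b \<in> Fx (2 * \<mu>)"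
  shows "cmod (cubic_sum (2 * \<mu>) a b) \<le> 7 * real p * real p ^ \<mu>"
proof -
  define m where "m = 2 * \<mu>"
  define B where "B = p ^ (2 * \<mu> - 1) + 7 * p ^ \<mu>"
  define Z where "Z = (\<lambda>n. cubic_level m a b (of_nat n))"
  have m: "m > 0" using assms(3) by (simp add: m_def)
  have fin: "finite (Fx m)" using finite_Fx m by simp
  have in_F: "a * x ^ 3 + b * x \<in> Fx m" if "x \<in> Fx m" for x
    using that ab by (simp add: Fx_intros m_def)
  have un: "Fx m = (\<Union>n<p. Z n)"
  proof
    show "Fx m \<subseteq> (\<Union>n<p. Z n)"
    proof
      fix x assume x: "x \<in> Fx m"
      then have "ff_trace p m (a * x ^ 3 + b * x) \<in> of_nat ` {..<p}"
        using ff_trace_in_prime[OF in_F] Fx_prime by simp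
      then show "x \<in> (\<Union>n<p. Z n)" using x by (auto simp: Z_def cubic_level_def)
    qed
  qed (auto simp: Z_def cubic_level_def)
  have dis: "Z n \<inter> Z n' = {}" if "n < p" "n' < p" "n \<noteq> n'" for n n'
    using that of_nat_inj_p[of n n'] by (auto simp: Z_def cubic_level_def)
  have finZ: "finite (Z n)" for n using fin by (auto simp: Z_def cubic_level_def)
  have cardZ: "(\<Sum>n<p. card (Z n)) = p ^ m"
    using card_UN_disjoint[of "{..<p}" Z] finZ dis un card_Fx[OF m] by simp
  have "cubic_sum m a b = (\<Sum>n<p. \<Sum>x\<in>Z n. add_char p m (a * x ^ 3 + b * x))"
    unfolding cubic_sum_def un by (rule sum.UNION_disjoint) (use finZ dis in auto)
  also have "\<dots> = (\<Sum>n<p. of_nat (card (Z n)) * root_unity n)"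
  proof (rule sum.cong[OF refl])
    fix n
    have "(\<Sum>x\<in>Z n. add_char p m (a * x ^ 3 + b * x)) = (\<Sum>x\<in>Z n. root_unity n)"
      by (rule sum.cong[OF refl], rule add_char_root_unity[OF in_F]) (auto simp: Z_def cubic_level_def)
    then show "(\<Sum>x\<in>Z n. add_char p m (a * x ^ 3 + b * x)) = of_nat (card (Z n)) * root_unity n"
      by simp
  qed
  also have "\<dots> = (\<Sum>n<p. (of_nat (card (Z n)) - of_nat B) * root_unity n) + of_nat B * (\<Sum>n<p. root_unity n)"
    by (simp add: left_diff_distrib sum_subtractf sum_distrib_left)
  also have "(\<Sum>n<p. root_unity n) = 0"
  proof -
    have "(\<Sum>n<p. root_unity n) = \<Sum>{z. z ^ p = 1}"
      using sum.reindex_bij_betw[OF bij_betw_roots_unity[OF p_pos], of "\<lambda>z. z"]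
      by (simp add: root_unity_cis)
    then show ?thesis using sum_roots_unity[OF p_gt_1] by simp
  qed
  finally have "cubic_sum m a b = (\<Sum>n<p. (of_nat (card (Z n)) - of_nat B) * root_unity n)" by simp
  then have "cmod (cubic_sum m a b) \<le> (\<Sum>n<p. cmod ((of_nat (card (Z n)) - of_nat B) * root_unity n))"
    by (simp add: norm_sum)
  also have "\<dots> = (\<Sum>n<p. real B - real (card (Z n)))"
  proof (rule sum.cong[OF refl])
    fix n
    have "card (Z n) \<le> B" unfolding Z_def m_def B_def by (rule card_cubic_level_le[OF assms(1-3)])
    then have "cmod (of_nat (card (Z n)) - of_nat B) = real B - real (card (Z n))"
      by (metis norm_minus_commute norm_of_nat of_nat_diff)
    then show "cmod ((of_nat (card (Z n)) - of_nat B) * root_unity n) = real B - real (card (Z n))"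
      by (simp add: norm_mult norm_root_unity)
  qed
  also have "\<dots> = real (p * B) - real (\<Sum>n<p. card (Z n))" by (simp add: sum_subtractf)
  also have "p * B = p ^ m + 7 * p * p ^ \<mu>"
    using assms(3) by (simp add: B_def m_def algebra_simps power_eq_if)
  finally show ?thesis by (simp add: cardZ m_def)
qed

end

section \<open>Quadratic extensions and the Weil bound\<close>

context alg_closed_char_p
begin

section \<open>Pairing elements by sum and product\<close>

lemma Fx_mono: "x \<in> Fx m \<Longrightarrow> x \<in> Fx (n * m)"
proof (induction n)
  case (Suc n)
  then show ?case by (simp add: Fx_def power_add power_mult)
qed (simp add: Fx_def)

lemma quadratic_split:
  fixes s t :: 'b
  obtains u v where "u + v = s" "u * v = t"
proof -
  have "degree [:t, - s, 1:] = 2" by simp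
  then obtain u where "poly [:t, - s, 1:] u = 0"
    using alg_closed_imp_poly_has_root[of "[:t, - s, 1:]"] by auto
  then have "t + u * (u - s) = 0" by simp
  then have "u * (s - u) = t" by (simp add: algebra_simps)
  then show ?thesis using that[of u "s - u"] by simp
qed

lemma sum_prod_eq_iff:
  fixes x y u v :: 'b
  shows "x + y = u + v \<and> x * y = u * v \<longleftrightarrow> x = u \<and> y = v \<or> x = v \<and> y = u"
proof
  assume eq: "x + y = u + v \<and> x * y = u * v"
  then have y: "y = u + v - x" by (metis add_diff_cancel_left')
  have "(x - u) * (x - v) = x * (x - (u + v)) + u * v" by (simp add: algebra_simps)
  also have "\<dots> = 0" using eq by (simp add: y algebra_simps)
  finally have "x = u \<or> x = v" by simp
  then show "x = u \<and> y = v \<or> x = v \<and> y = u" using eq by auto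
qed (auto simp: algebra_simps)

text \<open>Let u and v be the roots of \<open>X^2 - s X + t\<close>; the m-th Frobenius power
  permutes them. If it swaps two distinct roots, both lie in the second set only. If it fixes
  distinct roots, they give two ordered pairs. A double root gives one pair and one element of the
  second set.\<close>

lemma card_fibre:
  assumes p2: "p \<noteq> 2" and st: "s \<in> Fx m" "t \<in> Fx m"
  shows "card {(x, y) \<in> Fx m \<times> Fx m. x + y = s \<and> x * y = t}
    + card {x \<in> Fx (2 * m). x + x ^ (p ^ m) = s \<and> x * x ^ (p ^ m) = t} = 2"
    (is "card ?A + card ?B = 2")
proof -
  obtain u v where uv: "u + v = s" "u * v = t" using quadratic_split by blast
  have two: "(2 :: 'b) \<noteq> 0"
  proof
    assume "(2 :: 'b) = 0"
    then have "p dvd 2" using of_nat_eq_0_iff_char_dvd[where ?'a = 'b, of 2] CHAR_p by simp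
    then show False using dvd_imp_le[of p 2] p2 p_gt_1 by simp
  qed
  have uQ: "u ^ (p ^ m) + v ^ (p ^ m) = u + v \<and> u ^ (p ^ m) * v ^ (p ^ m) = u * v"
    using st uv by (metis (mono_tags, lifting) Fx_def frob_add mem_Collect_eq power_mult_distrib)
  then have cases: "u ^ (p ^ m) = u \<and> v ^ (p ^ m) = v \<or> u ^ (p ^ m) = v \<and> v ^ (p ^ m) = u"
    by (rule sum_prod_eq_iff[THEN iffD1])
  have QQ: "x ^ (p ^ (2 * m)) = (x ^ (p ^ m)) ^ (p ^ m)" for x :: 'b
    by (simp add: mult_2 power_add power_mult)
  have A: "?A = {(x, y) \<in> Fx m \<times> Fx m. x = u \<and> y = v \<or> x = v \<and> y = u}"
    using sum_prod_eq_iff[of _ _ u v] by (auto simp: uv)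
  have B: "?B = {x \<in> Fx (2 * m). x = u \<and> x ^ (p ^ m) = v \<or> x = v \<and> x ^ (p ^ m) = u}"
    using sum_prod_eq_iff[of _ _ u v] by (auto simp: uv)
  show ?thesis
  proof (cases "u ^ (p ^ m) = u")
    case True
    then have v: "v ^ (p ^ m) = v" using cases by auto
    have A': "?A = {(u, v), (v, u)}" unfolding A using True v by (auto simp: Fx_def)
    show ?thesis
    proof (cases "u = v")
      case True
      have B': "?B = {u}" unfolding B using True v by (auto simp: Fx_def QQ)
      show ?thesis unfolding A' B' using True by simp
    next
      case False
      have B': "?B = {}" unfolding B using False True v by auto
      show ?thesis unfolding A' B' using False by simp
    qed
  next
    case False
    then have v: "u ^ (p ^ m) = v" "v ^ (p ^ m) = u" "u \<noteq> v" using cases by auto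
    then have A': "?A = {}" unfolding A by (auto simp: Fx_def)
    have B': "?B = {u, v}" unfolding B using v by (auto simp: Fx_def QQ)
    show ?thesis unfolding A' B' using v by simp
  qed
qed

text \<open>Both the square of the sum over \<open>Fx m\<close> and the sum over
  \<open>Fx (2 * m)\<close> are sums of H weighted by the two fibre sizes of
  \<open>card_fibre\<close>. Adding them gives twice the unweighted sum of H, which is
  \<open>p ^ m\<close> because H is a character in t.\<close>

lemma cubic_sum_double:
  assumes m: "m > 0" and p23: "p \<noteq> 2" "p \<noteq> 3" and a0: "a \<noteq> 0" and ab: "a \<in> Fx m" "b \<in> Fx m"
  shows "cubic_sum (2 * m) a b = 2 * of_nat (p ^ m) - (cubic_sum m a b)\<^sup>2"
proof -
  define f where "f = (\<lambda>x. a * x ^ 3 + b * x)"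
  \<comment> \<open>For \<open>s = x + y\<close> and \<open>t = x * y\<close> the argument is
    \<open>f x + f y\<close>, by \<open>x^3 + y^3 = s^3 - 3 s t\<close>.\<close>
  define H where "H = (\<lambda>(s, t). add_char p m (a * (s ^ 3 - 3 * s * t) + b * s))"
  let ?A = "\<lambda>q. {z \<in> Fx m \<times> Fx m. (\<lambda>(x, y). (x + y, x * y)) z = q}"
  let ?B = "\<lambda>q. {x \<in> Fx (2 * m). (x + x ^ (p ^ m), x * x ^ (p ^ m)) = q}"
  have fin: "finite (Fx m)" "finite (Fx (2 * m))" using m finite_Fx by auto
  have in_F: "f x \<in> Fx m" if "x \<in> Fx m" for x using that ab by (simp add: f_def Fx_intros)
  have QQ: "x ^ (p ^ (2 * m)) = (x ^ (p ^ m)) ^ (p ^ m)" for x :: 'b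
    by (simp add: mult_2 power_add power_mult)
  have in_E: "x + x ^ (p ^ m) \<in> Fx m" "x * x ^ (p ^ m) \<in> Fx m" if "x \<in> Fx (2 * m)" for x
  proof -
    have "(x ^ (p ^ m)) ^ (p ^ m) = x" using QQ[of x] that by (simp add: Fx_def)
    then show "x + x ^ (p ^ m) \<in> Fx m" "x * x ^ (p ^ m) \<in> Fx m"
      by (simp_all add: Fx_def frob_add power_mult_distrib ac_simps)
  qed
  have three: "(3 :: 'b) \<noteq> 0"
  proof
    assume "(3 :: 'b) = 0"
    then have "p dvd 3" using of_nat_eq_0_iff_char_dvd[where ?'a = 'b, of 3] CHAR_p by simp
    then have "p = 2" using dvd_imp_le[of p 3] p_gt_1 p23 by auto
    then show False using p23 by simp
  qed
  have f_add: "f x + f y = a * ((x + y) ^ 3 - 3 * (x + y) * (x * y)) + b * (x + y)" for x y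
    by (simp add: f_def algebra_simps power3_eq_cube)
  have "(cubic_sum m a b)\<^sup>2 = (\<Sum>(x, y)\<in>Fx m \<times> Fx m. add_char p m (f x) * add_char p m (f y))"
    by (simp add: cubic_sum_def f_def power2_eq_square sum_product sum.cartesian_product)
  also have "\<dots> = (\<Sum>z\<in>Fx m \<times> Fx m. H ((\<lambda>(x, y). (x + y, x * y)) z))"
    by (rule sum.cong) (auto simp: H_def in_F f_add simp flip: add_char_add)
  also have "\<dots> = (\<Sum>q\<in>Fx m \<times> Fx m. \<Sum>z\<in>?A q. H ((\<lambda>(x, y). (x + y, x * y)) z))"
    by (rule sum.group [symmetric]) (use fin in \<open>auto simp: Fx_intros\<close>)
  also have "\<dots> = (\<Sum>q\<in>Fx m \<times> Fx m. of_nat (card (?A q)) * H q)"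
    by (rule sum.cong) auto
  finally have 1: "(cubic_sum m a b)\<^sup>2 = (\<Sum>q\<in>Fx m \<times> Fx m. of_nat (card (?A q)) * H q)" .
  have "cubic_sum (2 * m) a b = (\<Sum>x\<in>Fx (2 * m). H (x + x ^ (p ^ m), x * x ^ (p ^ m)))"
    unfolding cubic_sum_def
  proof (rule sum.cong[OF refl])
    fix x assume "x \<in> Fx (2 * m)"
    \<comment> \<open>Transitivity of the trace: first add the conjugate over \<open>Fx m\<close>,
      then take the trace of degree m.\<close>
    have "ff_trace p (2 * m) (f x) = ff_trace p m (f x + f x ^ (p ^ m))"
      unfolding ff_trace_add
      by (simp add: ff_trace_def mult_2 sum_lessThan_add power_add flip: power_mult)
    moreover have "f x ^ (p ^ m) = f (x ^ (p ^ m))"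
    proof -
      have "(x ^ 3) ^ (p ^ m) = (x ^ (p ^ m)) ^ 3" by (simp only: power_mult [symmetric] mult.commute)
      then show ?thesis using ab by (simp add: f_def frob_add power_mult_distrib Fx_def)
    qed
    ultimately show "add_char p (2 * m) (a * x ^ 3 + b * x) = H (x + x ^ (p ^ m), x * x ^ (p ^ m))"
      unfolding add_char_def H_def split f_add [symmetric] by (simp add: f_def)
  qed
  also have "\<dots> = (\<Sum>q\<in>Fx m \<times> Fx m. \<Sum>x\<in>?B q. H (x + x ^ (p ^ m), x * x ^ (p ^ m)))"
    by (rule sum.group [symmetric]) (use fin in_E in auto)
  also have "\<dots> = (\<Sum>q\<in>Fx m \<times> Fx m. of_nat (card (?B q)) * H q)"
    by (rule sum.cong) auto
  finally have 2: "cubic_sum (2 * m) a b = (\<Sum>q\<in>Fx m \<times> Fx m. of_nat (card (?B q)) * H q)" .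
  have card_nat: "card (?A q) + card (?B q) = 2" if "q \<in> Fx m \<times> Fx m" for q
  proof -
    obtain s t where q: "q = (s, t)" by fastforce
    have "?A q = {(x, y) \<in> Fx m \<times> Fx m. x + y = s \<and> x * y = t}"
      and "?B q = {x \<in> Fx (2 * m). x + x ^ (p ^ m) = s \<and> x * x ^ (p ^ m) = t}"
      by (auto simp: q)
    then show ?thesis using card_fibre[OF p23(1), of s m t] that by (simp add: q)
  qed
  have card: "of_nat (card (?A q)) + of_nat (card (?B q)) = (2 :: complex)"
    if "q \<in> Fx m \<times> Fx m" for q
    using arg_cong[OF card_nat[OF that], of "of_nat :: nat \<Rightarrow> complex"] by (simp only: of_nat_add of_nat_numeral)
  have "(cubic_sum m a b)\<^sup>2 + cubic_sum (2 * m) a b = (\<Sum>q\<in>Fx m \<times> Fx m. 2 * H q)"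
    unfolding 1 2 sum.distrib [symmetric]
    by (rule sum.cong) (simp_all only: distrib_right [symmetric] card)
  also have "\<dots> = 2 * (\<Sum>s\<in>Fx m. \<Sum>t\<in>Fx m. H (s, t))"
    by (simp add: sum_distrib_left sum.cartesian_product)
  also have "(\<Sum>s\<in>Fx m. \<Sum>t\<in>Fx m. H (s, t)) = (\<Sum>s\<in>Fx m. if s = 0 then of_nat (p ^ m) else 0)"
  proof (rule sum.cong[OF refl])
    fix s assume s: "s \<in> Fx m"
    \<comment> \<open>The coefficient of t in H. It vanishes only for \<open>s = 0\<close>, as
      \<open>p \<noteq> 3\<close> and \<open>a \<noteq> 0\<close>, so orthogonality leaves that
      single s.\<close>
    define c where "c = - (of_nat 3 * a * s)"
    have c: "c \<in> Fx m" unfolding c_def using ab s by (intro Fx_intros)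
    have c0: "c = 0 \<longleftrightarrow> s = 0" using three a0 by (simp add: c_def)
    have "H (s, t) = add_char p m (f s) * add_char p m (c * t)" if "t \<in> Fx m" for t
    proof -
      have "a * (s ^ 3 - 3 * s * t) + b * s = f s + c * t"
        by (simp add: f_def c_def algebra_simps)
      then show ?thesis using add_char_add[OF in_F[OF s] Fx_mult[OF c that]] by (simp add: H_def)
    qed
    then have "(\<Sum>t\<in>Fx m. H (s, t)) = add_char p m (f s) * (\<Sum>t\<in>Fx m. add_char p m (c * t))"
      by (simp add: sum_distrib_left)
    also have "\<dots> = (if s = 0 then of_nat (p ^ m) else 0)"
      unfolding sum_add_char_mult[OF m card_Fx[OF m] c] c0 by (simp add: f_def add_char_0)
    finally show "(\<Sum>t\<in>Fx m. H (s, t)) = (if s = 0 then of_nat (p ^ m) else 0)" .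
  qed
  also have "\<dots> = of_nat (p ^ m)" using fin by (simp add: Fx_0)
  finally show ?thesis by (simp add: algebra_simps)
qed

text \<open>The weak bound over the tower of quadratic extensions improves itself: if
  \<open>\<bar>\<epsilon>\<bar> / sqrt q = 2 + d\<close> over one field, then it is at least \<open>2 + 2d\<close> over its quadratic
  extension.\<close>

theorem weil_bound_cubic:
  assumes m: "m > 0" and p23: "p \<noteq> 2" "p \<noteq> 3" and a0: "a \<noteq> 0" and ab: "a \<in> Fx m" "b \<in> Fx m"
  shows "cmod (cubic_sum m a b) \<le> 2 * sqrt (real (p ^ m))"
proof (rule ccontr)
  assume contra: "\<not> ?thesis"
  define v where "v = (\<lambda>j. cmod (cubic_sum (2 ^ j * m) a b) / sqrt (real (p ^ (2 ^ j * m))))"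
  define d where "d = v 0 - 2"
  have pos: "real (p ^ n) > 0" for n using p_pos by simp
  have d: "d > 0" using contra pos[of m] by (simp add: d_def v_def field_simps)
  have ab': "a \<in> Fx (2 ^ j * m)" "b \<in> Fx (2 ^ j * m)" for j using ab Fx_mono by auto
  have sq: "sqrt (real (p ^ (2 ^ Suc j * m))) = real (p ^ (2 ^ j * m))" for j
    by (rule real_sqrt_unique) (simp_all add: mult_ac flip: power_mult)
  have step: "v (Suc j) \<ge> (v j)\<^sup>2 - 2" for j
  proof -
    let ?Q = "real (p ^ (2 ^ j * m))"
    let ?e = "cubic_sum (2 ^ j * m) a b"
    have Q: "?Q > 0" by (rule pos)
    have "cubic_sum (2 ^ Suc j * m) a b = 2 * of_nat (p ^ (2 ^ j * m)) - ?e\<^sup>2"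
      using cubic_sum_double[OF _ p23 a0 ab'[of j]] m by (simp add: mult.assoc)
    then have "cmod (cubic_sum (2 ^ Suc j * m) a b) \<ge> cmod (?e\<^sup>2) - cmod (2 * of_nat (p ^ (2 ^ j * m)))"
      by (metis norm_minus_commute norm_triangle_ineq2)
    then have "cmod (cubic_sum (2 ^ Suc j * m) a b) \<ge> (cmod ?e)\<^sup>2 - 2 * ?Q"
      by (simp add: norm_mult norm_power)
    then have "v (Suc j) \<ge> ((cmod ?e)\<^sup>2 - 2 * ?Q) / ?Q"
      unfolding v_def sq using Q by (intro divide_right_mono) auto
    also have "((cmod ?e)\<^sup>2 - 2 * ?Q) / ?Q = (v j)\<^sup>2 - 2"
      using Q by (simp add: v_def power_divide diff_divide_distrib)
    finally show ?thesis .
  qed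
  have low: "v j \<ge> 2 + 2 ^ j * d" for j
  proof (induction j)
    case (Suc j)
    let ?x = "2 ^ j * d"
    have "?x \<ge> 0" using d by simp
    then have "(2 + ?x)\<^sup>2 \<le> (v j)\<^sup>2" using Suc by (intro power_mono) auto
    moreover have "(2 + y)\<^sup>2 - 2 \<ge> 2 + 2 * y" if "y \<ge> 0" for y :: real
      using that by (simp add: power2_eq_square algebra_simps)
    note this[OF \<open>?x \<ge> 0\<close>]
    ultimately show ?case using step[of j] by simp
  qed (simp add: d_def)
  \<comment> \<open>The weak bound speaks of even exponents, hence \<open>Suc j\<close>. Normalized,
    it is \<open>7 * p\<close>, independent of j, and so cannot coexist with the exponential growth
    in \<open>low\<close>.\<close>
  have up: "v (Suc j) \<le> 7 * real p" for j
  proof -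
    have "cmod (cubic_sum (2 * (2 ^ j * m)) a b) \<le> 7 * real p * real p ^ (2 ^ j * m)"
      using norm_cubic_sum_le[OF a0 p23(2), of "2 ^ j * m" b] ab'[of "Suc j"] m
      by (simp add: mult.assoc)
    then show ?thesis
      unfolding v_def sq using pos[of "2 ^ j * m"] by (simp add: divide_le_eq mult.assoc)
  qed
  obtain n where "7 * real p / d < 2 ^ n" using real_arch_pow[of 2] by auto
  then have "7 * real p < 2 ^ n * d" using d by (simp add: divide_less_eq)
  also have "\<dots> \<le> 2 ^ Suc n * d" using d by simp
  finally show False using low[of "Suc n"] up[of n] by simp
qed

end

section \<open>Transfer to the given finite field\<close>

locale finite_char_p =
  fixes p e :: nat and K :: "'a::{field,finite} itself"
  assumes prime_p': "prime p" and card_UNIV: "card (UNIV :: 'a set) = p ^ e"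
begin

lemma CHAR_eq: "CHAR('a) = p"
proof -
  have "prime CHAR('a)"
    using finite_imp_CHAR_pos[where ?'a = 'a] prime_CHAR_semidom[where ?'a = 'a] by simp
  moreover have "CHAR('a) dvd p ^ e"
    using CHAR_dvd_CARD[where ?'a = 'a] card_UNIV by simp
  ultimately show ?thesis using prime_p' by (metis prime_dvd_power primes_dvd_imp_eq)
qed

sublocale char_p_field p K
  by standard (use prime_p' CHAR_eq in auto)

lemma e_pos: "e > 0"
proof -
  have "card {0, 1 :: 'a} \<le> card (UNIV :: 'a set)" by (rule card_mono) auto
  then show ?thesis using card_UNIV by (cases e) auto
qed

text \<open>Multiplication by a nonzero x permutes the nonzero elements; comparing their products
  gives \<open>x ^ (p ^ e - 1) = 1\<close>.\<close>

lemma Fx_e: "Fx e = (UNIV :: 'a set)"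
proof -
  have "x ^ (p ^ e) = x" if "x \<noteq> 0" for x :: 'a
  proof -
    let ?U = "UNIV - {0 :: 'a}"
    have "(\<Prod>y\<in>?U. y) = (\<Prod>y\<in>?U. x * y)"
      by (rule prod.reindex_bij_witness[of _ "\<lambda>y. x * y" "\<lambda>y. y / x"]) (use that in auto)
    also have "\<dots> = x ^ (p ^ e - 1) * (\<Prod>y\<in>?U. y)"
      by (simp add: prod.distrib card_Diff_singleton card_UNIV)
    finally have "x ^ (p ^ e - 1) = 1" by simp
    then show ?thesis by (metis One_nat_def Suc_pred mult.right_neutral p_pos power_Suc zero_less_power)
  qed
  then show ?thesis using p_pos by (auto simp: Fx_def zero_power) (metis zero_power p_pos zero_less_power)
qed

lemma add_char_to_ac: "add_char p e (to_ac x) = add_char p e (x :: 'a)"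
proof -
  have "ff_trace p e (to_ac x) = to_ac (ff_trace p e x)"
    by (simp add: ff_trace_def to_ac_sum)
  moreover have "(of_nat n = to_ac y) = (of_nat n = y)" for n and y :: 'a
    by (metis to_ac_of_nat to_ac_eq_iff)
  ultimately show ?thesis by (simp add: add_char_def prime_field_rep_def)
qed

text \<open>The embedding \<open>to_ac\<close> lands in \<open>ac.Fx e\<close>, which also has
  \<open>p ^ e\<close> elements. The image is thus the whole fixed field, and the sum becomes a
  \<open>cubic_sum\<close>.\<close>

lemma norm_cubic_exp_sum_le:
  fixes a b :: 'a
  assumes p23: "p \<noteq> 2" "p \<noteq> 3" and a0: "a \<noteq> 0"
  shows "cmod (exp_sum p e (\<lambda>x. a * x ^ 3 + b * x)) \<le> 2 * sqrt (real (p ^ e))"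
proof -
  interpret ac: alg_closed_char_p p "TYPE('a alg_closure)"
    by standard (use prime_p' CHAR_eq in auto)
  have in_F: "to_ac x \<in> ac.Fx e" for x :: 'a
    using Fx_e by (auto simp: Fx_def ac.Fx_def simp flip: to_ac_power)
  have inj: "inj (to_ac :: 'a \<Rightarrow> _)" by (rule inj_to_ac)
  have "card (range (to_ac :: 'a \<Rightarrow> _)) = card (ac.Fx e)"
    using card_image[OF inj] card_UNIV ac.card_Fx[OF e_pos] by simp
  then have range: "ac.Fx e = range to_ac"
    using card_subset_eq[OF ac.finite_Fx[OF e_pos], of "range to_ac"] in_F by auto
  have "ac.cubic_sum e (to_ac a) (to_ac b) = exp_sum p e (\<lambda>x. a * x ^ 3 + b * x)"
    unfolding ac.cubic_sum_def range exp_sum_def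
    by (simp add: sum.reindex[OF inj] flip: add_char_to_ac)
  then show ?thesis
    using ac.weil_bound_cubic[OF e_pos p23 _ in_F in_F, of a b] a0 by simp
qed

end

section \<open>Spectra of graphs diagonalized by characters\<close>

text \<open>If the second entry exceeded B, so would the first, but only the single occurrence c may
  exceed B.\<close>

lemma second_of_sorted_le:
  fixes M :: "real multiset"
  assumes "M = add_mset c M'" and "M' \<noteq> {#}" and le: "\<And>x. x \<in># M' \<Longrightarrow> x \<le> B"
  shows "rev (sorted_list_of_multiset M) ! 1 \<le> B"
proof (rule ccontr)
  assume gt: "\<not> ?thesis"
  define ys where "ys = rev (sorted_list_of_multiset M)"
  have mset_ys: "mset ys = M" by (simp add: ys_def)
  then have "length ys = Suc (size M')" "size M' > 0"
    using assms(1,2) by (metis size_mset size_add_mset, simp add: nonempty_has_size)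
  then obtain y0 y1 zs where ys: "ys = y0 # y1 # zs"
    by (metis Suc_length_conv gr0_conv_Suc)
  have "sorted (rev ys)" by (simp add: ys_def)
  then have "y1 \<le> y0" by (simp add: ys sorted_append)
  moreover have y1: "y1 > B" using gt by (simp add: ys flip: ys_def)
  ultimately have y0: "y0 \<notin># M'" using le by force
  have eq: "add_mset y0 (add_mset y1 (mset zs)) = add_mset c M'"
    using mset_ys assms(1) by (simp add: ys)
  have "y0 \<in># add_mset c M'" by (simp flip: eq)
  then have "y0 = c" using y0 by simp
  then have "y1 \<in># M'" using eq by (metis add_mset_add_mset_same_iff add_mset_remove_trivial union_single_eq_member)
  then show False using le y1 by force
qed

text \<open>Orthogonality makes the matrix U of the functions \<open>\<chi> w\<close> invertible
  with inverse W, and the eigenvalue equations say \<open>A * U = U * D\<close>. The diagonalization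
  is complex; injectivity of the coefficient embedding brings the identity back to the
  reals.\<close>

lemma char_poly_adj_matrix:
  fixes E :: "'v \<Rightarrow> 'v \<Rightarrow> bool" and \<chi> :: "'v \<Rightarrow> 'v \<Rightarrow> complex" and \<Lambda> :: "'v \<Rightarrow> real"
  assumes fin: "finite V"
    and eigen: "\<And>u w. u \<in> V \<Longrightarrow> w \<in> V \<Longrightarrow> (\<Sum>v\<in>V. if E u v then \<chi> w v else 0) = of_real (\<Lambda> w) * \<chi> w u"
    and orth: "\<And>w w'. w \<in> V \<Longrightarrow> w' \<in> V \<Longrightarrow>
      (\<Sum>v\<in>V. cnj (\<chi> w v) * \<chi> w' v) = (if w = w' then of_nat (card V) else 0)"
  shows "char_poly (adj_matrix V E) = (\<Prod>w\<in>V. [:- \<Lambda> w, 1:])"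
proof (cases "V = {}")
  case False
  interpret map_hom: map_poly_inj_comm_ring_hom "of_real :: real \<Rightarrow> complex" ..
  define N where "N = card V"
  have N0: "N > 0" using False fin by (simp add: N_def card_gt_0_iff)
  define h where "h = vertex_enum V"
  have h: "bij_betw h {0..<N} V"
    unfolding h_def vertex_enum_def N_def
    by (rule someI_ex[OF ex_bij_betw_nat_finite[OF fin]])
  then have hV: "h i \<in> V" if "i < N" for i using that by (auto simp: bij_betw_def)
  have h_eq: "h i = h j \<longleftrightarrow> i = j" if "i < N" "j < N" for i j
    using h that by (auto simp: bij_betw_def inj_on_def)
  have sum_h: "(\<Sum>i = 0..<N. g (h i)) = (\<Sum>v\<in>V. g v)" for g :: "'v \<Rightarrow> complex"
    by (rule sum.reindex_bij_betw[OF h])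
  define A :: "complex mat" where "A = map_mat of_real (adj_matrix V E)"
  define U where "U = mat N N (\<lambda>(i, j). \<chi> (h j) (h i))"
  define W where "W = mat N N (\<lambda>(i, j). cnj (\<chi> (h i) (h j)) / of_nat N)"
  define D :: "complex mat" where "D = mat N N (\<lambda>(i, j). if i = j then of_real (\<Lambda> (h i)) else 0)"
  have carrier: "A \<in> carrier_mat N N" "U \<in> carrier_mat N N" "W \<in> carrier_mat N N" "D \<in> carrier_mat N N"
    by (simp_all add: A_def adj_matrix_def U_def W_def D_def N_def)
  have adj: "adj_matrix V E \<in> carrier_mat N N" by (simp add: adj_matrix_def N_def)
  have WU: "W * U = 1\<^sub>m N"
  proof (rule eq_matI)
    fix i j assume ij: "i < dim_row (1\<^sub>m N :: complex mat)" "j < dim_col (1\<^sub>m N :: complex mat)"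
    then have "(W * U) $$ (i, j) = (\<Sum>l = 0..<N. cnj (\<chi> (h i) (h l)) * \<chi> (h j) (h l)) / of_nat N"
      by (simp add: W_def U_def scalar_prod_def sum_divide_distrib)
    also have "\<dots> = (if h i = h j then 1 else 0)"
      using sum_h[of "\<lambda>v. cnj (\<chi> (h i) v) * \<chi> (h j) v"] orth[of "h i" "h j"] ij hV N0
      by (simp add: N_def)
    finally show "(W * U) $$ (i, j) = (1\<^sub>m N) $$ (i, j)" using ij h_eq by simp
  qed (use carrier in auto)
  then have UW: "U * W = 1\<^sub>m N" by (rule mat_mult_left_right_inverse[OF carrier(3,2)])
  have "A * U = U * D"
  proof (rule eq_matI)
    fix i j assume "i < dim_row (U * D)" "j < dim_col (U * D)"
    then have ij: "i < N" "j < N" by (simp_all add: U_def D_def)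
    then have "(A * U) $$ (i, j) = (\<Sum>l = 0..<N. if E (h i) (h l) then \<chi> (h j) (h l) else 0)"
      by (auto simp: A_def adj_matrix_def U_def scalar_prod_def h_def N_def intro!: sum.cong)
    also have "\<dots> = of_real (\<Lambda> (h j)) * \<chi> (h j) (h i)"
      using sum_h[of "\<lambda>v. if E (h i) v then \<chi> (h j) v else 0"] eigen[of "h i" "h j"] ij hV by simp
    also have "\<dots> = (\<Sum>l = 0..<N. if l = j then \<chi> (h l) (h i) * of_real (\<Lambda> (h l)) else 0)"
      using ij by simp
    also have "\<dots> = (\<Sum>l = 0..<N. \<chi> (h l) (h i) * (if l = j then of_real (\<Lambda> (h l)) else 0))"
      by (rule sum.cong) auto
    also have "\<dots> = (U * D) $$ (i, j)"
      using ij by (simp add: U_def D_def scalar_prod_def)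
    finally show "(A * U) $$ (i, j) = (U * D) $$ (i, j)" .
  qed (use carrier in auto)
  then have "A = U * D * W"
    using carrier UW by (metis assoc_mult_mat right_mult_one_mat)
  then have "similar_mat A D"
    using similar_matI[of A D U W N] carrier UW WU by auto
  then have "char_poly A = char_poly D" by (rule char_poly_similar)
  also have "\<dots> = (\<Prod>a\<leftarrow>diag_mat D. [:- a, 1:])"
    by (rule char_poly_upper_triangular[OF carrier(4)]) (auto simp: D_def upper_triangular_def)
  also have "\<dots> = (\<Prod>i = 0..<N. [:- of_real (\<Lambda> (h i)), 1:])"
    by (simp add: diag_mat_def D_def prod.list_conv_set_nth atLeast0LessThan)
  also have "\<dots> = (\<Prod>w\<in>V. [:- of_real (\<Lambda> w), 1:])"
    by (rule prod.reindex_bij_betw[OF h])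
  also have "\<dots> = map_poly of_real (\<Prod>w\<in>V. [:- \<Lambda> w, 1:])"
    by (simp add: map_hom.hom_prod)
  finally have "map_poly of_real (char_poly (adj_matrix V E)) = map_poly (of_real :: real \<Rightarrow> complex) (\<Prod>w\<in>V. [:- \<Lambda> w, 1:])"
    by (simp add: A_def of_real_hom.char_poly_hom[OF adj])
  then show ?thesis by (rule map_hom.injectivity)
qed (simp add: adj_matrix_def char_poly_def char_poly_matrix_def)

lemma lambda2_le:
  fixes \<Lambda> :: "'v \<Rightarrow> real"
  assumes fin: "finite V" and cp: "char_poly (adj_matrix V E) = (\<Prod>w\<in>V. [:- \<Lambda> w, 1:])"
    and "w0 \<in> V" "V \<noteq> {w0}" and le: "\<And>w. w \<in> V \<Longrightarrow> w \<noteq> w0 \<Longrightarrow> \<Lambda> w \<le> B"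
  shows "lambda2 V E \<le> B"
proof -
  have "proots (char_poly (adj_matrix V E)) = (\<Sum>w\<in>V. {#\<Lambda> w#})"
    unfolding cp by (subst proots_prod) auto
  also have "\<dots> = add_mset (\<Lambda> w0) (\<Sum>w\<in>V - {w0}. {#\<Lambda> w#})"
    using assms by (simp add: sum.remove[of V w0])
  finally show ?thesis
    unfolding lambda2_def
    by (rule second_of_sorted_le) (use assms in \<open>auto simp: sum_eq_empty_iff set_mset_sum\<close>)
qed

section \<open>The graph\<close>

locale cubic_graph = finite_char_p p e K for p e and K :: "'a::{field,finite} itself" +
  fixes k :: nat
  assumes k3: "3 \<le> k" and ke: "k \<le> e + 2" and odd_q: "odd (p ^ e)" and q_mod_3: "p ^ e mod 3 = 2"
begin

abbreviation \<psi> :: "'a \<Rightarrow> complex" where "\<psi> \<equiv> add_char p e"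

abbreviation V :: "(nat \<Rightarrow> 'a) set" where "V \<equiv> S_vertices k"

lemma p_ne_2: "p \<noteq> 2"
  using odd_q e_pos by auto

lemma p_ne_3: "p \<noteq> 3"
proof
  assume "p = 3"
  then have "p ^ e mod 3 = 0" using e_pos by (simp add: mod_eq_0_iff_dvd)
  then show False using q_mod_3 by simp
qed

lemma q_ge_5: "5 \<le> p ^ e"
proof -
  have "p \<noteq> 4" using prime_p by auto
  then have "5 \<le> p" using p_ne_2 p_ne_3 p_gt_1 by linarith
  also have "p \<le> p ^ e" using e_pos p_pos by (simp add: self_le_power)
  finally show ?thesis .
qed

lemma psi_add: "\<psi> (x + y) = \<psi> x * \<psi> y"
  by (rule add_char_add) (simp_all add: Fx_e)

lemma psi_uminus: "\<psi> (- x) = cnj (\<psi> x)"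
  by (rule add_char_uminus) (simp add: Fx_e)

lemma psi_frob: "\<psi> (x ^ (p ^ i)) = \<psi> x"
  by (rule add_char_frob) (simp add: Fx_e)

lemma psi_sum: "\<psi> (\<Sum>i\<in>A. f i) = (\<Prod>i\<in>A. \<psi> (f i))"
  by (rule add_char_sum) (simp add: Fx_e)

lemma sum_psi: "(\<Sum>x\<in>UNIV. \<psi> (c * x)) = (if c = 0 then of_nat (p ^ e) else 0)"
  using sum_add_char_mult[OF e_pos, of c] by (simp add: Fx_e card_UNIV)

lemma psi_nontrivial: "\<exists>c. \<psi> c \<noteq> 1"
  using add_char_nontrivial[OF e_pos] by (simp add: Fx_e card_UNIV)

lemma power_q: "x ^ (p ^ e) = (x :: 'a)"
  using Fx_e by (auto simp: Fx_def)

lemma bij_cube: "bij (\<lambda>x :: 'a. x ^ 3)"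
proof -
  define q where "q = p ^ e"
  \<comment> \<open>Since \<open>q mod 3 = 2\<close>, 3 divides \<open>2 * q - 1\<close>, and the
    n-th power inverts cubing because \<open>x ^ (2 * q - 1) = x\<close>.\<close>
  define n where "n = (2 * q - 1) div 3"
  have q: "q mod 3 = 2" "5 \<le> q" using q_mod_3 q_ge_5 by (simp_all add: q_def)
  then have n: "3 * n = q + (q - 1)" unfolding n_def by presburger
  have cube: "(x ^ 3) ^ n = x" for x :: 'a
  proof -
    have "(x ^ 3) ^ n = x ^ q * x ^ (q - 1)"
      by (simp only: power_mult [symmetric] power_add [symmetric] n)
    also have "\<dots> = x ^ Suc (q - 1)" by (simp add: power_q q_def)
    also have "Suc (q - 1) = q" using q(2) by simp
    finally show ?thesis by (simp add: power_q q_def)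
  qed
  have "inj (\<lambda>x :: 'a. x ^ 3)" by (rule injI) (metis cube)
  then show ?thesis using finite_UNIV_inj_surj[of "\<lambda>x :: 'a. x ^ 3"] by (simp add: bij_def)
qed

lemma bij_frob: "bij (\<lambda>x :: 'a. x ^ (p ^ i))"
proof -
  have "inj (\<lambda>x :: 'a. x ^ (p ^ i))" by (rule injI) (simp add: frob_inj)
  then show ?thesis using finite_UNIV_inj_surj[of "\<lambda>x :: 'a. x ^ (p ^ i)"] by (simp add: bij_def)
qed

section \<open>Cubic sums over the field and their maximum\<close>

definition \<epsilon> :: "'a \<Rightarrow> 'a \<Rightarrow> complex" where
  "\<epsilon> a b = exp_sum p e (\<lambda>x. a * x ^ 3 + b * x)"

lemma eps_0_right: "\<epsilon> a 0 = (if a = 0 then of_nat (p ^ e) else 0)"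
  using sum.reindex_bij_betw[OF bij_cube, of "\<lambda>x. \<psi> (a * x)"] sum_psi[of a]
  by (simp add: \<epsilon>_def exp_sum_def)

lemma eps_0_left: "b \<noteq> 0 \<Longrightarrow> \<epsilon> 0 b = 0"
  using sum_psi[of b] by (simp add: \<epsilon>_def exp_sum_def)

lemma finite_M_q_set: "finite {Re (\<epsilon> a b) | a b. a \<noteq> 0 \<and> b \<noteq> 0}"
proof (rule finite_subset)
  show "{Re (\<epsilon> a b) | a b. a \<noteq> 0 \<and> b \<noteq> 0} \<subseteq> (\<lambda>(a, b). Re (\<epsilon> a b)) ` UNIV" by auto
qed simp

lemma M_q_eq_Max: "M_q p e TYPE('a) = Max {Re (\<epsilon> a b) | a b. a \<noteq> 0 \<and> b \<noteq> 0}"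
  by (simp add: M_q_def \<epsilon>_def)

lemma eps_le_M_q: "a \<noteq> 0 \<Longrightarrow> b \<noteq> 0 \<Longrightarrow> Re (\<epsilon> a b) \<le> M_q p e TYPE('a)"
  unfolding M_q_eq_Max by (rule Max_ge[OF finite_M_q_set]) auto

lemma M_q_le: "M_q p e TYPE('a) \<le> 2 * sqrt (real (p ^ e))"
proof -
  have "Re (\<epsilon> a b) \<le> 2 * sqrt (real (p ^ e))" if "a \<noteq> 0" for a b
    using norm_cubic_exp_sum_le[OF p_ne_2 p_ne_3 that, of b] complex_Re_le_cmod[of "\<epsilon> a b"]
    by (simp add: \<epsilon>_def)
  moreover have "Re (\<epsilon> 1 1) \<in> {Re (\<epsilon> a b) | a b. a \<noteq> 0 \<and> b \<noteq> 0}"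
    using one_neq_zero by blast
  ultimately show ?thesis unfolding M_q_eq_Max by (subst Max_le_iff[OF finite_M_q_set]) auto
qed

text \<open>The sums \<open>\<epsilon> 1 b\<close> over all b add up to q, which is positive, while
  \<open>\<epsilon> 1 0 = 0\<close>; so not all the others can have negative real part.\<close>

lemma M_q_nonneg: "0 \<le> M_q p e TYPE('a)"
proof (rule ccontr)
  assume neg: "\<not> 0 \<le> M_q p e TYPE('a)"
  have "(\<Sum>b\<in>UNIV. \<epsilon> 1 b) = (\<Sum>x\<in>UNIV. \<Sum>b\<in>UNIV. \<psi> (x ^ 3) * \<psi> (x * b))"
    unfolding \<epsilon>_def exp_sum_def by (subst sum.swap) (simp add: psi_add mult.commute)
  also have "\<dots> = (\<Sum>x\<in>(UNIV :: 'a set). if x = 0 then of_nat (p ^ e) else 0)"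
    by (rule sum.cong) (auto simp: sum_psi add_char_0 simp flip: sum_distrib_left)
  also have "\<dots> = of_nat (p ^ e)" by simp
  finally have "(\<Sum>b\<in>UNIV. Re (\<epsilon> 1 b)) = real (p ^ e)"
    by (metis Re_complex_of_real Re_sum of_real_of_nat_eq)
  moreover have "(\<Sum>b\<in>UNIV. Re (\<epsilon> 1 b)) \<le> 0"
  proof (rule sum_nonpos)
    fix b :: 'a
    show "Re (\<epsilon> 1 b) \<le> 0"
      using eps_le_M_q[of 1 b] eps_0_right[of 1] neg by (cases "b = 0") auto
  qed
  moreover have "real (p ^ e) > 4" using q_ge_5 by linarith
  ultimately show False by linarith
qed

lemma eps_le_M_q_of_nz: "b \<noteq> 0 \<Longrightarrow> Re (\<epsilon> a b) \<le> M_q p e TYPE('a)"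
  using eps_le_M_q[of a b] eps_0_left[of b] M_q_nonneg by (cases "a = 0") auto

section \<open>Characters of the vertex group\<close>

definition dot :: "(nat \<Rightarrow> 'a) \<Rightarrow> (nat \<Rightarrow> 'a) \<Rightarrow> 'a" where
  "dot w v = (\<Sum>i = 1..k. w i * v i)"

lemma dot_commute: "dot w v = dot v w"
  by (simp add: dot_def mult.commute)

lemma dot_add: "dot w (\<lambda>i. u i + v i) = dot w u + dot w v"
  by (simp add: dot_def distrib_left sum.distrib)

lemma dot_diff: "dot w (\<lambda>i. u i - v i) = dot w u - dot w v"
  by (simp add: dot_def right_diff_distrib sum_subtractf)

lemma dot_zero: "dot (\<lambda>_. 0) v = 0"
  by (simp add: dot_def)

lemma V_zero: "(\<lambda>_. 0) \<in> V"
  by (simp add: S_vertices_def)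

lemma V_outside: "v \<in> V \<Longrightarrow> i < 1 \<or> k < i \<Longrightarrow> v i = 0"
  by (auto simp: S_vertices_def)

lemma V_add: "u \<in> V \<Longrightarrow> v \<in> V \<Longrightarrow> (\<lambda>i. u i + v i) \<in> V"
  by (simp add: S_vertices_def)

lemma V_diff: "u \<in> V \<Longrightarrow> v \<in> V \<Longrightarrow> (\<lambda>i. u i - v i) \<in> V"
  by (simp add: S_vertices_def)

lemma finite_V: "finite V"
proof (rule finite_subset)
  show "V \<subseteq> {f. \<forall>i. (i \<in> {1..k} \<longrightarrow> f i \<in> UNIV) \<and> (i \<notin> {1..k} \<longrightarrow> f i = 0)}"
    by (auto intro: V_outside)
  show "finite {f :: nat \<Rightarrow> 'a. \<forall>i. (i \<in> {1..k} \<longrightarrow> f i \<in> UNIV) \<and> (i \<notin> {1..k} \<longrightarrow> f i = 0)}"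
    by (rule finite_set_of_finite_funs) auto
qed

lemma sum_psi_dot:
  assumes "u \<in> V"
  shows "(\<Sum>v\<in>V. \<psi> (dot u v)) = (if u = (\<lambda>_. 0) then of_nat (card V) else 0)"
proof (cases "u = (\<lambda>_. 0)")
  case False
  then obtain j where j: "u j \<noteq> 0" by auto
  then have "\<not> (j < 1 \<or> k < j)" using V_outside[OF assms] by blast
  then have jk: "j \<in> {1..k}" by auto
  obtain c where c: "\<psi> c \<noteq> 1" using psi_nontrivial by blast
  \<comment> \<open>A vector supported at one coordinate where u is nonzero, scaled so that
    translation by it multiplies the sum by \<open>\<psi> c\<close>.\<close>
  define d where "d = (\<lambda>i. if i = j then c / u j else 0)"
  have d: "d \<in> V" using jk by (auto simp: d_def S_vertices_def)
  have "dot u d = (\<Sum>i = 1..k. if i = j then c else 0)"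
    unfolding dot_def d_def by (rule sum.cong) (use j in auto)
  then have ud: "dot u d = c" using jk by simp
  have "(\<Sum>v\<in>V. \<psi> (dot u v)) = (\<Sum>v\<in>V. \<psi> (dot u (\<lambda>i. v i + d i)))"
    by (rule sum.reindex_bij_witness[of _ "\<lambda>v i. v i + d i" "\<lambda>v i. v i - d i"])
      (auto simp: V_add V_diff d)
  also have "\<dots> = (\<Sum>v\<in>V. \<psi> (dot u v)) * \<psi> c"
    by (simp add: dot_add psi_add ud sum_distrib_right)
  finally show ?thesis using c False by simp
qed (simp add: dot_zero add_char_0)

section \<open>The connection set and the eigenvalues\<close>

definition gen :: "'a \<Rightarrow> 'a \<Rightarrow> nat \<Rightarrow> 'a" where
  "gen x t i = (if i = 1 then x else if i = 2 then x * t
    else if i \<in> {3..k} then x ^ 3 * t ^ (p ^ (i - 2)) else 0)"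

definition D :: "('a \<times> 'a) set" where "D = (UNIV - {0}) \<times> UNIV"

lemma card_D: "card D = (p ^ e - 1) * p ^ e"
  by (simp add: D_def card_cartesian_product card_UNIV card_Diff_singleton)

lemma gen_V: "gen x t \<in> V"
  using k3 by (auto simp: gen_def S_vertices_def)

lemma gen_inj: "inj_on (\<lambda>(x, t). gen x t) D"
proof (rule inj_onI, clarify)
  fix x t x' t' assume D: "(x, t) \<in> D" "(x', t') \<in> D" and eq: "gen x t = gen x' t'"
  have "x = x'" using fun_cong[OF eq, of 1] by (simp add: gen_def)
  moreover have "x * t = x' * t'" using fun_cong[OF eq, of 2] by (simp add: gen_def)
  ultimately show "x = x' \<and> t = t'" using D by (auto simp: D_def)
qed

lemma gen_uminus: "gen (- x) t = (\<lambda>i. - gen x t i)"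
  by (auto simp: gen_def)

abbreviation adj :: "(nat \<Rightarrow> 'a) \<Rightarrow> (nat \<Rightarrow> 'a) \<Rightarrow> bool" where
  "adj \<equiv> S_adj k (\<lambda>i x. x ^ (p ^ (i - 2))) (\<lambda>i x. x ^ 3)"

text \<open>This exhibits the Cayley structure: x is the difference of the first coordinates and t
  the ratio of the second difference to it.\<close>

lemma adj_iff:
  assumes "u \<in> V"
  shows "adj u v \<longleftrightarrow> (\<exists>(x, t)\<in>D. v = (\<lambda>i. u i + gen x t i))"
proof
  assume adj: "adj u v"
  define x where "x = v 1 - u 1"
  define t where "t = (v 2 - u 2) / x"
  have x: "x \<noteq> 0" and vV: "v \<in> V" using adj by (auto simp: S_adj_def x_def)
  have "v i = u i + gen x t i" for i
  proof -
    consider "i = 1" | "i = 2" | "i \<in> {3..k}" | "i < 1 \<or> k < i" by fastforce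
    then show ?thesis
    proof cases
      case 3
      then have "v i - u i = x ^ 3 * t ^ (p ^ (i - 2))"
        using adj by (auto simp: S_adj_def x_def t_def)
      then show ?thesis using 3 by (simp add: gen_def algebra_simps)
    next
      case 4
      then have "u i = 0" "v i = 0" "gen x t i = 0"
        using V_outside assms vV gen_V[of x t] by auto
      then show ?thesis by simp
    qed (use x in \<open>simp_all add: gen_def x_def t_def\<close>)
  qed
  then show "\<exists>(x, t)\<in>D. v = (\<lambda>i. u i + gen x t i)"
    using x by (intro bexI[of _ "(x, t)"]) (auto simp: D_def)
next
  assume "\<exists>(x, t)\<in>D. v = (\<lambda>i. u i + gen x t i)"
  then obtain x t where x: "x \<noteq> 0" and v: "v = (\<lambda>i. u i + gen x t i)" by (auto simp: D_def)
  have "v \<in> V" unfolding v by (rule V_add[OF assms gen_V])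
  then show "adj u v" using x assms by (auto simp: S_adj_def v gen_def)
qed

definition eig :: "(nat \<Rightarrow> 'a) \<Rightarrow> complex" where
  "eig w = (\<Sum>(x, t)\<in>D. \<psi> (dot w (gen x t)))"

text \<open>The connection set is closed under negation, since \<open>x ^ 3\<close> is odd, so the
  sum equals its conjugate.\<close>

lemma eig_real: "eig w = of_real (Re (eig w))"
proof -
  have neg: "dot w (\<lambda>i. - v i) = - dot w v" for v by (simp add: dot_def sum_negf)
  have "cnj (eig w) = (\<Sum>(x, t)\<in>D. \<psi> (dot w (gen (- x) t)))"
    by (simp add: eig_def case_prod_unfold gen_uminus neg psi_uminus)
  also have "\<dots> = eig w"
    unfolding eig_def
    by (rule sum.reindex_bij_witness[of _ "\<lambda>(x, t). (- x, t)" "\<lambda>(x, t). (- x, t)"]) (auto simp: D_def)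
  finally show ?thesis by (simp add: complex_eq_iff)
qed

lemma adj_sum:
  assumes "u \<in> V"
  shows "(\<Sum>v\<in>V. if adj u v then \<psi> (dot w v) else 0) = of_real (Re (eig w)) * \<psi> (dot w u)"
proof -
  have inj: "inj_on (\<lambda>(x, t) i. u i + gen x t i) D"
  proof (rule inj_onI, clarify)
    fix x t x' t' assume D: "(x, t) \<in> D" "(x', t') \<in> D"
      and eq: "(\<lambda>i. u i + gen x t i) = (\<lambda>i. u i + gen x' t' i)"
    have "gen x t = gen x' t'" using fun_cong[OF eq] by (intro ext) simp
    then show "x = x' \<and> t = t'" using inj_onD[OF gen_inj, of "(x, t)" "(x', t')"] D by simp
  qed
  have image: "{v \<in> V. adj u v} = (\<lambda>(x, t) i. u i + gen x t i) ` D"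
    using adj_iff[OF assms] V_add[OF assms gen_V] by (auto simp: image_iff)
  have "(\<Sum>v\<in>V. if adj u v then \<psi> (dot w v) else 0) = (\<Sum>v\<in>{v \<in> V. adj u v}. \<psi> (dot w v))"
    by (simp add: sum.If_cases[OF finite_V] Int_def)
  also have "\<dots> = (\<Sum>(x, t)\<in>D. \<psi> (dot w (\<lambda>i. u i + gen x t i)))"
    unfolding image sum.reindex[OF inj] by (simp add: case_prod_unfold)
  also have "\<dots> = eig w * \<psi> (dot w u)"
    by (simp add: eig_def dot_add psi_add sum_distrib_left case_prod_unfold mult.commute)
  finally show ?thesis using eig_real by metis
qed

section \<open>Bounding the nontrivial eigenvalues\<close>

definition Acoef :: "(nat \<Rightarrow> 'a) \<Rightarrow> 'a \<Rightarrow> 'a" where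
  "Acoef w t = (\<Sum>i = 3..k. w i * t ^ (p ^ (i - 2)))"

lemma dot_gen: "dot w (gen x t) = Acoef w t * x ^ 3 + (w 1 + w 2 * t) * x"
proof -
  have k: "{1..k} = insert 1 (insert 2 {3..k})" using k3 by auto
  have "(\<Sum>i = 3..k. w i * gen x t i) = Acoef w t * x ^ 3"
    unfolding Acoef_def sum_distrib_right by (rule sum.cong) (auto simp: gen_def)
  moreover have "dot w (gen x t) = w 1 * gen x t 1 + (w 2 * gen x t 2 + (\<Sum>i = 3..k. w i * gen x t i))"
    unfolding dot_def k by simp
  moreover have "gen x t 1 = x" "gen x t 2 = x * t" by (simp_all add: gen_def)
  ultimately show ?thesis by (simp add: algebra_simps)
qed

text \<open>The linear coefficient \<open>B t\<close> vanishes only at \<open>t0\<close>, where the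
  inner sum is at most q. Leaving out \<open>x = 0\<close> subtracts 1 for each t, so the total is
  at most \<open>(q - 1) + (q - 1) * (M_q - 1)\<close>.\<close>

lemma Re_eig_le_of_nonzero:
  assumes "w 2 \<noteq> 0"
  shows "Re (eig w) \<le> real (p ^ e - 1) * M_q p e TYPE('a)"
proof -
  define B where "B = (\<lambda>t. w 1 + w 2 * t)"
  define t0 where "t0 = - w 1 / w 2"
  have B: "B t = 0 \<longleftrightarrow> t = t0" for t
    using assms by (auto simp: B_def t0_def field_simps add_eq_0_iff)
  have "eig w = (\<Sum>t\<in>UNIV. \<Sum>x\<in>UNIV - {0}. \<psi> (Acoef w t * x ^ 3 + B t * x))"
    unfolding eig_def D_def dot_gen B_def sum.cartesian_product [symmetric] by (rule sum.swap)
  also have "\<dots> = (\<Sum>t\<in>UNIV. \<epsilon> (Acoef w t) (B t) - 1)"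
    by (simp add: \<epsilon>_def exp_sum_def sum_diff1 add_char_0)
  finally have "Re (eig w) = (\<Sum>t\<in>UNIV. Re (\<epsilon> (Acoef w t) (B t)) - 1)"
    by simp
  also have "\<dots> \<le> (\<Sum>t\<in>UNIV. if t = t0 then real (p ^ e) - 1 else M_q p e TYPE('a) - 1)"
  proof (rule sum_mono)
    fix t
    show "Re (\<epsilon> (Acoef w t) (B t)) - 1 \<le> (if t = t0 then real (p ^ e) - 1 else M_q p e TYPE('a) - 1)"
      using eps_le_M_q_of_nz[of "B t" "Acoef w t"] eps_0_right[of "Acoef w t"] B[of t] by auto
  qed
  also have "\<dots> = (real (p ^ e) - 1) + (\<Sum>t\<in>UNIV - {t0}. M_q p e TYPE('a) - 1)"
    by (simp add: sum.remove[of UNIV t0])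
  also have "\<dots> = real (p ^ e - 1) * M_q p e TYPE('a)"
    using q_ge_5 by (simp add: card_Diff_singleton card_UNIV of_nat_diff algebra_simps)
  finally show ?thesis .
qed

text \<open>The linearized polynomial whose roots are the z for which
  \<open>\<psi> (Acoef w t * z) = 1\<close> for every t.\<close>

definition Lpoly :: "(nat \<Rightarrow> 'a) \<Rightarrow> 'a poly" where
  "Lpoly w = (\<Sum>i = 3..k. monom (w i ^ (p ^ (k - i))) (p ^ (k - i)))"

text \<open>Applying a power of Frobenius to each summand makes all of them linear in the same variable
  \<open>t ^ p ^ (k - 2)\<close>.\<close>

lemma psi_Acoef: "\<psi> (Acoef w t * z) = \<psi> (poly (Lpoly w) z * t ^ (p ^ (k - 2)))"
proof -
  have "\<psi> (w i * t ^ (p ^ (i - 2)) * z) = \<psi> ((w i * z) ^ (p ^ (k - i)) * t ^ (p ^ (k - 2)))"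
    if "i \<in> {3..k}" for i
  proof -
    have "(t ^ (p ^ (i - 2))) ^ (p ^ (k - i)) = t ^ (p ^ (k - 2))"
      using that by (simp flip: power_mult power_add)
    then have "(w i * t ^ (p ^ (i - 2)) * z) ^ (p ^ (k - i)) = (w i * z) ^ (p ^ (k - i)) * t ^ (p ^ (k - 2))"
      by (simp add: power_mult_distrib)
    then show ?thesis by (metis psi_frob)
  qed
  then show ?thesis
    by (simp add: Acoef_def Lpoly_def poly_sum poly_monom sum_distrib_right psi_sum power_mult_distrib)
qed

lemma sum_psi_Acoef:
  "(\<Sum>t\<in>UNIV. \<psi> (Acoef w t * z)) = (if poly (Lpoly w) z = 0 then of_nat (p ^ e) else 0)"
  using sum.reindex_bij_betw[OF bij_frob, of "\<lambda>t. \<psi> (poly (Lpoly w) z * t)" "k - 2"]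
    sum_psi[of "poly (Lpoly w) z"] by (simp add: psi_Acoef)

lemma eig_eq_of_zero:
  assumes "w 2 = 0"
  shows "eig w = of_nat (p ^ e) * (\<Sum>x | x \<noteq> 0 \<and> poly (Lpoly w) (x ^ 3) = 0. \<psi> (w 1 * x))"
proof -
  have "eig w = (\<Sum>x\<in>UNIV - {0}. \<psi> (w 1 * x) * (\<Sum>t\<in>UNIV. \<psi> (Acoef w t * x ^ 3)))"
    unfolding eig_def D_def dot_gen sum.cartesian_product [symmetric]
    by (simp add: assms psi_add sum_distrib_left mult.commute)
  also have "\<dots> = (\<Sum>x\<in>UNIV - {0}. if poly (Lpoly w) (x ^ 3) = 0 then of_nat (p ^ e) * \<psi> (w 1 * x) else 0)"
    unfolding sum_psi_Acoef by (rule sum.cong) auto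
  also have "\<dots> = (\<Sum>x | x \<noteq> 0 \<and> poly (Lpoly w) (x ^ 3) = 0. of_nat (p ^ e) * \<psi> (w 1 * x))"
    by (rule sum.mono_neutral_cong_right) auto
  finally show ?thesis by (simp add: sum_distrib_left)
qed

text \<open>The exponents of \<open>Lpoly w\<close> are distinct, so \<open>w i\<close> leaves a
  nonzero coefficient and there are at most \<open>p ^ (k - 3)\<close> roots. Cubing embeds the set
  into the roots other than 0.\<close>

lemma Lpoly_roots:
  assumes "i \<in> {3..k}" "w i \<noteq> 0"
  shows "card {x. x \<noteq> 0 \<and> poly (Lpoly w) (x ^ 3) = 0} \<le> p ^ (k - 3) - 1"
proof -
  have "coeff (Lpoly w) (p ^ (k - i)) = (\<Sum>j = 3..k. if j = i then w i ^ (p ^ (k - i)) else 0)"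
    unfolding Lpoly_def coeff_sum
  proof (rule sum.cong[OF refl])
    fix j assume "j \<in> {3..k}"
    then have "p ^ (k - j) = p ^ (k - i) \<longleftrightarrow> j = i"
      using assms(1) p_gt_1 by (auto simp: power_inject_exp)
    then show "coeff (monom (w j ^ p ^ (k - j)) (p ^ (k - j))) (p ^ (k - i)) = (if j = i then w i ^ (p ^ (k - i)) else 0)"
      by auto
  qed
  also have "\<dots> = w i ^ (p ^ (k - i))" using assms(1) by simp
  finally have "coeff (Lpoly w) (p ^ (k - i)) \<noteq> 0" using assms(2) by simp
  then have L0: "Lpoly w \<noteq> 0" by auto
  have deg: "degree (Lpoly w) \<le> p ^ (k - 3)"
    unfolding Lpoly_def
    by (rule degree_sum_le) (use p_gt_1 in \<open>auto intro!: order.trans[OF degree_monom_le] power_increasing\<close>)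
  let ?R = "{z. poly (Lpoly w) z = 0}"
  have R: "card ?R \<le> p ^ (k - 3)"
    using card_poly_roots_bound[OF L0] deg by simp
  have "poly (Lpoly w) 0 = 0"
    using p_pos by (simp add: Lpoly_def poly_sum poly_monom zero_power)
  then have "card (?R - {0}) = card ?R - 1" by (simp add: card_Diff_singleton)
  moreover have "card {x. x \<noteq> 0 \<and> poly (Lpoly w) (x ^ 3) = 0} \<le> card (?R - {0})"
    by (rule card_inj_on_le[of "\<lambda>x. x ^ 3"]) (use bij_cube in \<open>auto simp: bij_def inj_on_def\<close>)
  ultimately show ?thesis using R by linarith
qed

lemma Re_eig_le:
  assumes "w \<in> V" "w \<noteq> (\<lambda>_. 0)"
  shows "Re (eig w) \<le> max (real (p ^ e) * (real (p ^ (k - 3)) - 1)) (real (p ^ e - 1) * M_q p e TYPE('a))"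
proof (cases "w 2 = 0")
  case w2: True
  let ?X = "{x. x \<noteq> 0 \<and> poly (Lpoly w) (x ^ 3) = 0}"
  have Re: "Re (eig w) = real (p ^ e) * Re (\<Sum>x\<in>?X. \<psi> (w 1 * x))"
    using eig_eq_of_zero[of w, OF w2] by simp
  show ?thesis
  proof (cases "\<exists>i\<in>{3..k}. w i \<noteq> 0")
    case True
    then obtain i where i: "i \<in> {3..k}" "w i \<noteq> 0" by blast
    have "Re (\<Sum>x\<in>?X. \<psi> (w 1 * x)) \<le> cmod (\<Sum>x\<in>?X. \<psi> (w 1 * x))" by (rule complex_Re_le_cmod)
    also have "\<dots> \<le> (\<Sum>x\<in>?X. cmod (\<psi> (w 1 * x)))" by (rule norm_sum)
    also have "\<dots> = real (card ?X)" by (simp add: norm_add_char)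
    also have "\<dots> \<le> real (p ^ (k - 3) - 1)" using Lpoly_roots[where w = w, OF i] by simp
    also have "\<dots> = real (p ^ (k - 3)) - 1" using p_pos by (simp add: of_nat_diff)
    finally have "Re (eig w) \<le> real (p ^ e) * (real (p ^ (k - 3)) - 1)"
      unfolding Re by (rule mult_left_mono) simp
    then show ?thesis by simp
  next
    case False
    then have wi: "w i = 0" if "i \<in> {3..k}" for i using that by blast
    have "w 1 \<noteq> 0"
    proof
      assume "w 1 = 0"
      have "w i = 0" for i
      proof -
        consider "i = 1" | "i = 2" | "i \<in> {3..k}" | "i < 1 \<or> k < i" by fastforce
        then show ?thesis using \<open>w 1 = 0\<close> w2 wi assms(1) by cases (auto simp: S_vertices_def)
      qed
      then show False using assms(2) by auto
    qed
    \<comment> \<open>Only \<open>w 1\<close> is nonzero here: every nonzero x is counted, the sum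
      is -1, and the eigenvalue is \<open>- q\<close>.\<close>
    have "Lpoly w = 0" using wi p_pos by (simp add: Lpoly_def zero_power)
    then have "?X = UNIV - {0}" by auto
    then have "(\<Sum>x\<in>?X. \<psi> (w 1 * x)) = - 1"
      using sum_psi[of "w 1"] \<open>w 1 \<noteq> 0\<close> by (simp add: sum_diff1 add_char_0)
    then have "Re (eig w) \<le> 0" unfolding Re by simp
    also have "0 \<le> real (p ^ e - 1) * M_q p e TYPE('a)" using M_q_nonneg by simp
    finally show ?thesis by simp
  qed
next
  case False
  then show ?thesis using Re_eig_le_of_nonzero[of w] by simp
qed

section \<open>Comparison with the degree, connectedness and the second eigenvalue\<close>

lemma eigenvalue_bound_less: "max (real (p ^ e) * (real (p ^ (k - 3)) - 1)) (real (p ^ e - 1) * M_q p e TYPE('a)) < real (card D)"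
proof -
  have q: "real (p ^ e) > 4" using q_ge_5 by linarith
  \<comment> \<open>The hypothesis \<open>k \<le> e + 2\<close> enters here, giving
    \<open>k - 3 < e\<close>.\<close>
  have "p ^ (k - 3) < p ^ e" using ke k3 e_pos p_gt_1 by (intro power_strict_increasing) auto
  then have "real (p ^ (k - 3)) < real (p ^ e)" by linarith
  then have 1: "real (p ^ e) * (real (p ^ (k - 3)) - 1) < real (p ^ e) * (real (p ^ e) - 1)"
    using q p_pos by (intro mult_strict_left_mono) auto
  have "2 * sqrt (real (p ^ e)) < sqrt (real (p ^ e)) * sqrt (real (p ^ e))"
  proof (rule mult_strict_right_mono)
    show "2 < sqrt (real (p ^ e))" by (rule real_less_rsqrt) (use q in simp)
    then show "0 < sqrt (real (p ^ e))" by linarith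
  qed
  then have "M_q p e TYPE('a) < real (p ^ e)" using M_q_le by simp
  then have 2: "real (p ^ e - 1) * M_q p e TYPE('a) < real (p ^ e - 1) * real (p ^ e)"
    using q q_ge_5 by (intro mult_strict_left_mono) auto
  have "real (p ^ e - 1) = real (p ^ e) - 1" using q_ge_5 by (simp add: of_nat_diff)
  then have D1: "real (p ^ e) * (real (p ^ e) - 1) = real (card D)"
    and D2: "real (p ^ e - 1) * real (p ^ e) = real (card D)"
    by (simp_all only: card_D of_nat_mult mult.commute)
  show ?thesis using 1 2 unfolding D1 D2 max_less_iff_conj by blast
qed

text \<open>A character trivial on the connection set would have the degree as its eigenvalue,
  contradicting the strict bound.\<close>

lemma psi_gen_nontrivial:
  assumes "w \<in> V" "w \<noteq> (\<lambda>_. 0)"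
  obtains x t where "(x, t) \<in> D" "\<psi> (dot w (gen x t)) \<noteq> 1"
proof -
  have "\<exists>(x, t)\<in>D. \<psi> (dot w (gen x t)) \<noteq> 1"
  proof (rule ccontr)
    assume "\<not> ?thesis"
    then have "eig w = (\<Sum>z\<in>D. 1)" unfolding eig_def by (intro sum.cong) auto
    then have "Re (eig w) = real (card D)" by simp
    then show False using Re_eig_le[OF assms] eigenvalue_bound_less by simp
  qed
  then show ?thesis using that by blast
qed

text \<open>The indicator function of a component is invariant under the connection set, so its Fourier
  transform vanishes at every nontrivial character.\<close>

lemma connected: "connected_graph V adj"
  unfolding connected_graph_def
proof (intro ballI)
  fix u v assume u: "u \<in> V" and v: "v \<in> V"
  define C where "C = {y \<in> V. adj\<^sup>*\<^sup>* u y}"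
  have uC: "u \<in> C" using u by (simp add: C_def)
  have finC: "finite C" using finite_V by (simp add: C_def)
  have C_add: "(\<lambda>i. y i + gen x t i) \<in> C" if "y \<in> C" "(x, t) \<in> D" for y x t
  proof -
    have "adj y (\<lambda>i. y i + gen x t i)" using that adj_iff[of y] by (auto simp: C_def)
    then show ?thesis
      using that V_add gen_V by (auto simp: C_def intro: rtranclp.rtrancl_into_rtrancl)
  qed
  \<comment> \<open>Negating x negates the generator, so C is closed under subtraction too and
    translation by a generator permutes it.\<close>
  have C_diff: "(\<lambda>i. y i - gen x t i) \<in> C" if "y \<in> C" "(x, t) \<in> D" for y x t
    using C_add[of y "- x" t] that by (simp add: gen_uminus D_def)
  define F where "F = (\<lambda>w. \<Sum>y\<in>C. \<psi> (dot w y))"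
  have F0: "F w = 0" if w: "w \<in> V" "w \<noteq> (\<lambda>_. 0)" for w
  proof -
    obtain x t where xt: "(x, t) \<in> D" "\<psi> (dot w (gen x t)) \<noteq> 1" using psi_gen_nontrivial[OF w] .
    have "F w = (\<Sum>y\<in>C. \<psi> (dot w (\<lambda>i. y i + gen x t i)))"
      unfolding F_def
      by (rule sum.reindex_bij_witness[of _ "\<lambda>y i. y i + gen x t i" "\<lambda>y i. y i - gen x t i"])
        (auto simp: C_add C_diff xt)
    also have "\<dots> = F w * \<psi> (dot w (gen x t))"
      by (simp add: F_def dot_add psi_add sum_distrib_right)
    finally show ?thesis using xt(2) by simp
  qed
  have "of_nat (card C) = F (\<lambda>_. 0)" by (simp add: F_def dot_zero add_char_0)
  \<comment> \<open>Fourier inversion at v: only the zero vector contributes to this sum, while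
    exchanging the sums yields \<open>card V\<close> times the indicator of C at v. As C is
    nonempty, v must lie in it.\<close>
  also have "\<dots> = (\<Sum>w\<in>V. F w * \<psi> (- dot w v))"
    using sum.remove[OF finite_V V_zero, of "\<lambda>w. F w * \<psi> (- dot w v)"] F0
    by (simp add: dot_zero add_char_0)
  also have "\<dots> = (\<Sum>y\<in>C. \<Sum>w\<in>V. \<psi> (dot (\<lambda>i. y i - v i) w))"
    unfolding F_def sum_distrib_right
    by (subst sum.swap) (simp add: psi_add [symmetric] dot_diff dot_commute[of "\<lambda>i. _ i - _ i"])
  also have "\<dots> = (\<Sum>y\<in>C. if y = v then of_nat (card V) else 0)"
  proof (rule sum.cong[OF refl])
    fix y assume "y \<in> C"
    then have "(\<lambda>i. y i - v i) \<in> V" using v V_diff by (auto simp: C_def)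
    moreover have "(\<lambda>i. y i - v i) = (\<lambda>_. 0) \<longleftrightarrow> y = v" by (auto simp: fun_eq_iff)
    ultimately show "(\<Sum>w\<in>V. \<psi> (dot (\<lambda>i. y i - v i) w)) = (if y = v then of_nat (card V) else 0)"
      using sum_psi_dot by auto
  qed
  finally have "of_nat (card C) = (if v \<in> C then of_nat (card V) else (0 :: complex))"
    using finC by simp
  moreover have "card C > 0" using uC finC by (auto simp: card_gt_0_iff)
  ultimately have "v \<in> C" by (auto split: if_splits)
  then show "adj\<^sup>*\<^sup>* u v" by (simp add: C_def)
qed

lemma lambda2_bound:
  "lambda2 V adj \<le> max (real (p ^ e) * (real (p ^ (k - 3)) - 1)) (real (p ^ e - 1) * M_q p e TYPE('a))"
proof (rule lambda2_le[OF finite_V _ V_zero])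
  show "char_poly (adj_matrix V adj) = (\<Prod>w\<in>V. [:- Re (eig w), 1:])"
  proof (rule char_poly_adj_matrix[OF finite_V])
    fix w w' assume w: "w \<in> V" "w' \<in> V"
    have "(\<Sum>v\<in>V. cnj (\<psi> (dot w v)) * \<psi> (dot w' v)) = (\<Sum>v\<in>V. \<psi> (dot (\<lambda>i. w' i - w i) v))"
      by (simp add: psi_uminus [symmetric] psi_add [symmetric] dot_diff dot_commute[of "\<lambda>i. _ i - _ i"] dot_commute)
    moreover have "(\<lambda>i. w' i - w i) = (\<lambda>_. 0) \<longleftrightarrow> w = w'" by (auto simp: fun_eq_iff)
    ultimately show "(\<Sum>v\<in>V. cnj (\<psi> (dot w v)) * \<psi> (dot w' v)) = (if w = w' then of_nat (card V) else 0)"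
      using sum_psi_dot[OF V_diff[OF w(2,1)]] by simp
  qed (rule adj_sum)
  have "gen 1 0 \<noteq> (\<lambda>_. 0)" by (auto simp: gen_def fun_eq_iff intro: exI[of _ 1])
  then show "V \<noteq> {\<lambda>_. 0}" using gen_V[of 1 0] by auto
qed (rule Re_eig_le)

end

theorem theorem4:
  fixes p e k :: nat
  assumes "prime p" and "card (UNIV :: 'a set) = p ^ e"
    and "odd (p ^ e)" and "p ^ e mod 3 = 2"
    and "3 \<le> k" and "k \<le> e + 2"
  shows "connected_graph (S_vertices k :: (nat \<Rightarrow> 'a::{field,finite}) set)
           (S_adj k (\<lambda>i x. x ^ (p ^ (i - 2))) (\<lambda>i x. x ^ 3))
       \<and> lambda2 (S_vertices k :: (nat \<Rightarrow> 'a) set)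
           (S_adj k (\<lambda>i x. x ^ (p ^ (i - 2))) (\<lambda>i x. x ^ 3))
         \<le> max (real (p ^ e) * (real (p ^ (k - 3)) - 1)) (real (p ^ e - 1) * M_q p e TYPE('a))
       \<and> M_q p e TYPE('a) \<le> 2 * sqrt (real (p ^ e))"
proof -
  interpret cubic_graph p e "TYPE('a)" k
    by standard (use assms in auto)
  show ?thesis using connected lambda2_bound M_q_le by blast
qed

end
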